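(* (i) Let $p\in(1,2]$. Let $\psi:[1,\infty)\to[1,\infty)$ be an increasing function with $\psi(1)=1$ such that for every integer $d\geq 1$ there is a constant $C_{p,d}<\infty$ such that for all weights $w,\sigma$ on $\mathbb{R}^d$ with $[\sigma]_{A_\infty}<\infty$, $$\|S(\cdot\,\sigma)\|_{L^p(\sigma)\to L^p(w)}\leq C_{p,d}\,[w,\sigma]_{A_p}^{1/p}\,\psi([\sigma]_{A_\infty}).$$ Then there is an absolute constant $A>0$ such that $\psi(x)\gtrsim_p x^{1/p}$ for all $x>A$. (ii) Let $p\in(2,\infty)$. Let $\phi,\psi:[1,\infty)\to[1,\infty)$ be increasing functions (depending only on $p$) with $\phi(1)=\psi(1)=1$ such that for every integer $d\geq1$ there is a constant $C_{p,d}<\infty$ such that for all weights $w,\sigma$ on $\mathbb{R}^d$ with $[\sigma]_{A_\infty}<\infty$ and $[w]_{A_\infty}<\infty$, $$\|S(\cdot\,\sigma)\|_{L^p(\sigma)\to L^p(w)}\leq C_{p,d}\,[w,\sigma]_{A_p}^{1/p}\,\big(\phi([w]_{A_\infty})+\psi([\sigma]_{A_\infty})\big).$$ Then there are absolute constants $A,B>0$ such that $\psi(x)\gtrsim_p x^{1/p}$ for all $x>A$ and $\phi(x)\gtrsim_p x^{\frac12-\frac1p}$ for all $x>B$.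
   Context: Here $g(x)\gtrsim_p h(x)$ means $g(x)\geq c\,h(x)$ with a constant $c>0$ independent of $x$. The functions $\phi,\psi$ and the constants $C_{p,d}$ are regarded as attached to $p$, so $c$ may depend on $p$, on these functions and on the constants $C_{p,d}$. A cube in $\mathbb{R}^d$ is a set $[a_1,b_1)\times\cdots\times[a_d,b_d)$ with $a_i<b_i$ for all $i$ (as literally defined; equality of side lengths is not demanded). A dyadic cube is a set $\prod_{i=1}^d[k_i2^{-n},(k_i+1)2^{-n})$ with $n,k_1,\dots,k_d\in\mathbb{Z}$; $\mathcal{D}$ is the family of all dyadic cubes in $\mathbb{R}^d$, and $\mathrm{ch}(Q)$ is the set of the $2^d$ dyadic children of $Q\in\mathcal{D}$ (the maximal dyadic cubes strictly contained in $Q$). $|\cdot|$ and $dx$ denote Lebesgue measure, $\langle f\rangle_Q=\frac1{|Q|}\int_Qf\,dx$, $\sigma(Q)=\int_Q\sigma\,dx$. For $f\in L^1_{\mathrm{loc}}(\mathbb{R}^d)$ and $Q\in\mathcal{D}$ put $\Delta_Qf=\sum_{R\in\mathrm{ch}(Q)}\langle f\rangle_R1_R-\langle f\rangle_Q1_Q$. The dyadic square function is $Sf(x)=\big(\sum_{Q\in\mathcal{D}}(\Delta_Qf(x))^2\big)^{1/2}$, $x\in\mathbb{R}^d$. A weight on $\mathbb{R}^d$ is a measurable function that is positive a.e. and integrable over every cube. $L^p(\sigma)=L^p(\mathbb{R}^d,\sigma(x)\,dx)$, and $\|S(\cdot\,\sigma)\|_{L^p(\sigma)\to L^p(w)}\in[0,\infty]$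 is the least $C$ such that $\|S(f\sigma)\|_{L^p(w)}\leq C\|f\|_{L^p(\sigma)}$ for all $f\in L^p(\sigma)$. For weights $w,\sigma$ on $\mathbb{R}^d$: $$[\sigma]_{A_\infty}=\sup_{Q}\frac1{\sigma(Q)}\int_Q M_Q\sigma(x)\,dx,\qquad M_Q\sigma(x)=\sup\{\langle\sigma\rangle_R: R\subseteq Q\text{ a cube},\ x\in R\},$$ $$[w,\sigma]_{A_p}=\sup_Q\langle w\rangle_Q\langle\sigma\rangle_Q^{p-1},$$ the suprema over $Q$ being over all cubes $Q\subseteq\mathbb{R}^d$. *)

theory Defs
  imports "HOL-Analysis.Analysis"
begin

text \<open>
  Since the dimension d is quantified inside the statement, \<open>\<real>\<^sup>d\<close> is modelled as
  the space \<open>{..<d} \<rightarrow>\<^sub>E UNIV\<close> of the \<open>d\<close>-fold product measure. The completion makes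
  "measurable" mean Lebesgue measurable.
\<close>

definition lebd :: "nat \<Rightarrow> (nat \<Rightarrow> real) measure" where
  "lebd d = completion (\<Pi>\<^sub>M i\<in>{..<d}. (lborel :: real measure))"

text \<open>The side lengths of a cube are not required to be equal.\<close>

definition cubes :: "nat \<Rightarrow> (nat \<Rightarrow> real) set set" where
  "cubes d = {Q. \<exists>a b. (\<forall>i<d. a i < b i) \<and> Q = (\<Pi>\<^sub>E i\<in>{..<d}. {a i..<b i})}"

definition dyadic :: "nat \<Rightarrow> (nat \<Rightarrow> real) set set" where
  "dyadic d = {Q. \<exists>(n::int) (k::nat \<Rightarrow> int).
     Q = (\<Pi>\<^sub>E i\<in>{..<d}. {of_int (k i) * 2 powi (-n)..<(of_int (k i) + 1) * 2 powi (-n)})}"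

definition children :: "nat \<Rightarrow> (nat \<Rightarrow> real) set \<Rightarrow> (nat \<Rightarrow> real) set set" where
  "children d Q = {R \<in> dyadic d. R \<subset> Q \<and> \<not> (\<exists>R'\<in>dyadic d. R \<subset> R' \<and> R' \<subset> Q)}"

definition average :: "nat \<Rightarrow> ((nat \<Rightarrow> real) \<Rightarrow> real) \<Rightarrow> (nat \<Rightarrow> real) set \<Rightarrow> real" where
  "average d f Q = (LINT x:Q|lebd d. f x) / measure (lebd d) Q"

definition mart_diff ::
    "nat \<Rightarrow> (nat \<Rightarrow> real) set \<Rightarrow> ((nat \<Rightarrow> real) \<Rightarrow> real) \<Rightarrow> (nat \<Rightarrow> real) \<Rightarrow> real" where
  "mart_diff d Q f x =
     (\<Sum>R\<in>children d Q. average d f R * indicator R x) - average d f Q * indicator Q x"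

text \<open>Powers with a positive real exponent on \<open>[0,\<infinity>]\<close>; only used for \<open>a > 0\<close>.\<close>

definition epowr :: "ennreal \<Rightarrow> real \<Rightarrow> ennreal" where
  "epowr t a = (if t = \<infinity> then \<infinity> else ennreal (enn2real t powr a))"

definition square_fun ::
    "nat \<Rightarrow> ((nat \<Rightarrow> real) \<Rightarrow> real) \<Rightarrow> (nat \<Rightarrow> real) \<Rightarrow> ennreal" where
  "square_fun d f x = epowr (\<Sum>\<^sub>\<infinity>Q\<in>dyadic d. ennreal ((mart_diff d Q f x)\<^sup>2)) (1/2)"

definition is_weight :: "nat \<Rightarrow> ((nat \<Rightarrow> real) \<Rightarrow> real) \<Rightarrow> bool" where
  "is_weight d w \<longleftrightarrow> w \<in> borel_measurable (lebd d) \<and> (AE x in lebd d. 0 < w x) \<and>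
     (\<forall>Q\<in>cubes d. set_integrable (lebd d) Q w)"

definition weighted :: "nat \<Rightarrow> ((nat \<Rightarrow> real) \<Rightarrow> real) \<Rightarrow> (nat \<Rightarrow> real) measure" where
  "weighted d w = density (lebd d) (\<lambda>x. ennreal (w x))"

definition Lp_norm :: "real \<Rightarrow> 'a measure \<Rightarrow> ('a \<Rightarrow> ennreal) \<Rightarrow> ennreal" where
  "Lp_norm p M g = epowr (\<integral>\<^sup>+x. epowr (g x) p \<partial>M) (1/p)"

definition Lp :: "real \<Rightarrow> 'a measure \<Rightarrow> ('a \<Rightarrow> real) set" where
  "Lp p M = {f \<in> borel_measurable M. Lp_norm p M (\<lambda>x. ennreal \<bar>f x\<bar>) < \<infinity>}"

text \<open>The operator norm of \<open>f \<mapsto> S(f \<sigma>)\<close> from \<open>L\<^sup>p(\<sigma>)\<close> to \<open>L\<^sup>p(w)\<close>, with values in \<open>[0,\<infinity>]\<close>.\<close>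

definition S_norm ::
    "nat \<Rightarrow> real \<Rightarrow> ((nat \<Rightarrow> real) \<Rightarrow> real) \<Rightarrow> ((nat \<Rightarrow> real) \<Rightarrow> real) \<Rightarrow> ennreal" where
  "S_norm d p w \<sigma> = Inf {C. \<forall>f\<in>Lp p (weighted d \<sigma>).
     Lp_norm p (weighted d w) (square_fun d (\<lambda>x. f x * \<sigma> x))
       \<le> C * Lp_norm p (weighted d \<sigma>) (\<lambda>x. ennreal \<bar>f x\<bar>)}"

definition local_max ::
    "nat \<Rightarrow> (nat \<Rightarrow> real) set \<Rightarrow> ((nat \<Rightarrow> real) \<Rightarrow> real) \<Rightarrow> (nat \<Rightarrow> real) \<Rightarrow> ennreal" where
  "local_max d Q \<sigma> x = (SUP R\<in>{R \<in> cubes d. R \<subseteq> Q \<and> x \<in> R}. ennreal (average d \<sigma> R))"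

definition A_infty :: "nat \<Rightarrow> ((nat \<Rightarrow> real) \<Rightarrow> real) \<Rightarrow> ennreal" where
  "A_infty d \<sigma> = (SUP Q\<in>cubes d.
     (\<integral>\<^sup>+x\<in>Q. local_max d Q \<sigma> x \<partial>lebd d) / ennreal (LINT x:Q|lebd d. \<sigma> x))"

definition A_p ::
    "nat \<Rightarrow> real \<Rightarrow> ((nat \<Rightarrow> real) \<Rightarrow> real) \<Rightarrow> ((nat \<Rightarrow> real) \<Rightarrow> real) \<Rightarrow> ennreal" where
  "A_p d p w \<sigma> = (SUP Q\<in>cubes d. ennreal (average d w Q * average d \<sigma> Q powr (p - 1)))"

text \<open>An increasing (that is, nondecreasing) function \<open>[1,\<infinity>) \<rightarrow> [1,\<infinity>)\<close> with value 1 at 1.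
  Values at arguments below 1 are irrelevant.\<close>

definition growth_fun :: "(real \<Rightarrow> real) \<Rightarrow> bool" where
  "growth_fun \<psi> \<longleftrightarrow> \<psi> \<in> {1..} \<rightarrow> {1..} \<and> mono_on {1..} \<psi> \<and> \<psi> 1 = 1"

end

theory Submission
  imports Defs
begin

text \<open>
  It suffices to test the bounds in dimension one, on power weights with parameter
  \<open>t = 4 / x \<rightarrow> 0\<close>.

  For \<open>\<psi>\<close> take \<open>\<sigma>(y) = \<bar>y\<bar>\<^sup>t\<^sup>-\<^sup>1\<close> and \<open>w = \<sigma>\<^sup>1\<^sup>-\<^sup>p\<close>. Every average of \<open>\<sigma>\<close> is at most \<open>4 / t\<close> times its
  infimum, so that \<open>\<sigma>\<close> has \<open>A\<^sub>\<infinity>\<close> constant at most \<open>4 / t\<close>, the pair has \<open>A\<^sub>p\<close> constant at most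
  \<open>(4 / t)\<^sup>p\<^sup>-\<^sup>1\<close>, and the \<open>A\<^sub>\<infinity>\<close> constant of \<open>w\<close> is bounded. For \<open>f = 1\<^bsub>[0,1)\<^esub>\<close> one has
  \<open>S(f\<sigma>) \<ge> \<sigma> / (4t)\<close> on \<open>[0,1)\<close>, so the norm is at least \<open>1 / (4t)\<close>, which exceeds
  \<open>(4 / t)\<^bsup>(p-1)/p\<^esup>\<close> by a factor of order \<open>t\<^bsup>-1/p\<^esup>\<close>.

  For \<open>\<phi>\<close> the roles are exchanged: \<open>w(y) = \<bar>y\<bar>\<^sup>t\<^sup>-\<^sup>1\<close> and \<open>\<sigma> = w\<^bsup>-1/(p-1)\<^esup>\<close>, with \<open>A\<^sub>p\<close> constant at most
  \<open>4 / t\<close>. Taking \<open>f\<sigma>\<close> of alternating sign on the dyadic annuli makes \<open>n \<approx> 1 / t\<close> martingale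
  differences comparable on \<open>[0,2\<^sup>-\<^sup>n)\<close>, so the norm is at least of order \<open>t\<^bsup>-1/2\<^esup>\<close>, to be compared with
  \<open>t\<^bsup>-1/p\<^esup>\<close>.

  In both cases the function whose argument stays bounded is absorbed in the constant.
\<close>

declare One_nat_def [simp del] \<comment> \<open>otherwise the dimension 1 is rewritten to \<open>Suc 0\<close>\<close>

section \<open>The one-dimensional case on the real line\<close>

definition seg :: "real \<Rightarrow> real \<Rightarrow> (nat \<Rightarrow> real) set" where
  "seg a b = (\<Pi>\<^sub>E i\<in>{..<1}. {a..<b})"

definition avg :: "(real \<Rightarrow> real) \<Rightarrow> real \<Rightarrow> real \<Rightarrow> real" where
  "avg u a b = (LBINT y:{a..<b}. u y) / (b - a)"

section \<open>Transfer of integrals from the one-fold product to the line\<close>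

lemma space_lebd1: "space (lebd 1) = (\<Pi>\<^sub>E i\<in>{..<1}. UNIV)"
  by (simp add: lebd_def space_PiM)

lemma mem_seg_iff: "x \<in> space (lebd 1) \<Longrightarrow> x \<in> seg a b \<longleftrightarrow> x 0 \<in> {a..<b}"
  by (auto simp: seg_def space_lebd1 PiE_iff)

lemma indicator_seg:
  "x \<in> space (lebd 1) \<Longrightarrow> indicator (seg a b) x = (indicator {a..<b} (x 0) :: 'a :: zero_neq_one)"
  using mem_seg_iff[of x a b] by (simp add: indicator_def del: atLeastLessThan_iff)

text \<open>The hypothesis excludes an empty left-hand side. Constant functions on
  \<open>{..<1}\<close> reduce the claim to inclusion of real intervals.\<close>

lemma seg_subset_iff:
  assumes "a < b" shows "seg a b \<subseteq> seg c d \<longleftrightarrow> c \<le> a \<and> b \<le> d"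
proof -
  have "seg a b \<subseteq> seg c d \<longleftrightarrow> {a..<b} \<subseteq> {c..<d}"
  proof
    assume *: "seg a b \<subseteq> seg c d"
    show "{a..<b} \<subseteq> {c..<d}"
    proof
      fix y assume "y \<in> {a..<b}"
      hence "(\<lambda>i\<in>{..<1::nat}. y) \<in> seg a b" by (auto simp: seg_def)
      hence "(\<lambda>i\<in>{..<1::nat}. y) \<in> seg c d" using * by blast
      thus "y \<in> {c..<d}" by (auto simp: seg_def PiE_iff)
    qed
  next
    assume "{a..<b} \<subseteq> {c..<d}"
    thus "seg a b \<subseteq> seg c d" unfolding seg_def by (intro PiE_mono) auto
  qed
  thus ?thesis using assms by simp
qed

lemma seg_psubset_iff:
  assumes "a < b" "c < d"
  shows "seg a b \<subset> seg c d \<longleftrightarrow> c \<le> a \<and> b \<le> d \<and> \<not> (a \<le> c \<and> d \<le> b)"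
  by (simp only: less_le_not_le seg_subset_iff[OF assms(1)] seg_subset_iff[OF assms(2)] conj_assoc)

lemma cubes_1: "cubes 1 = {seg a b |a b. a < b}"
proof -
  have "(\<Pi>\<^sub>E i\<in>{..<1::nat}. {a i..<b i}) = seg (a 0) (b 0)" for a b :: "nat \<Rightarrow> real"
    unfolding seg_def by (intro PiE_cong) auto
  thus ?thesis
    unfolding cubes_def by (auto intro: exI[of _ "\<lambda>_. _"])
qed

lemma proj_lebd1_measurable [measurable]: "(\<lambda>x. x 0) \<in> lebd 1 \<rightarrow>\<^sub>M borel"
proof -
  have "(\<lambda>x. x 0) \<in> (\<Pi>\<^sub>M i\<in>{..<1::nat}. (lborel :: real measure)) \<rightarrow>\<^sub>M lborel"
    by (rule measurable_component_singleton) simp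
  hence "(\<lambda>x. x 0) \<in> (\<Pi>\<^sub>M i\<in>{..<1::nat}. (lborel :: real measure)) \<rightarrow>\<^sub>M borel" by simp
  thus ?thesis unfolding lebd_def by (rule measurable_completion)
qed

text \<open>Completion does not change the distribution of the coordinate, and a product over one
  index is its only factor. Integrals of functions of \<open>x 0\<close> pass to the line through
  this identity.\<close>

lemma distr_lebd1: "distr (lebd 1) borel (\<lambda>x. x 0) = lborel"
proof -
  interpret product_sigma_finite "\<lambda>_::nat. lborel :: real measure"
    by standard
  have eq: "{..<1::nat} = {0}" by auto
  have m: "(\<lambda>x. x 0) \<in> (\<Pi>\<^sub>M i\<in>{0::nat}. (lborel :: real measure)) \<rightarrow>\<^sub>M lborel"
    by (rule measurable_component_singleton) simp
  have "distr (lebd 1) borel (\<lambda>x. x 0) =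
      distr (\<Pi>\<^sub>M i\<in>{0::nat}. (lborel :: real measure)) borel (\<lambda>x. x 0)"
    unfolding lebd_def eq using m by (intro distr_completion) simp
  \<comment> \<open>\<open>distr_singleton\<close> has target \<open>lborel\<close>, which has the
    same measurable sets as \<open>borel\<close>.\<close>
  also have "\<dots> = distr (\<Pi>\<^sub>M i\<in>{0::nat}. (lborel :: real measure)) lborel (\<lambda>x. x 0)"
    by (intro distr_cong) auto
  also have "\<dots> = lborel" by (rule distr_singleton)
  finally show ?thesis .
qed

lemma nn_integral_lebd1:
  fixes f :: "real \<Rightarrow> ennreal"
  assumes "f \<in> borel_measurable borel"
  shows "(\<integral>\<^sup>+x. f (x 0) \<partial>lebd 1) = (\<integral>\<^sup>+y. f y \<partial>lborel)"
  using nn_integral_distr[OF proj_lebd1_measurable, of f] assms by (simp add: distr_lebd1)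

lemma AE_lebd1:
  assumes "AE y in lborel. P y"
  shows "AE x in lebd 1. P (x 0)"
  using AE_distrD[OF proj_lebd1_measurable, of P] assms unfolding distr_lebd1 by blast

lemma nn_integral_seg:
  fixes f :: "real \<Rightarrow> ennreal"
  assumes [measurable]: "f \<in> borel_measurable borel"
  shows "(\<integral>\<^sup>+x\<in>seg a b. f (x 0) \<partial>lebd 1) = (\<integral>\<^sup>+y\<in>{a..<b}. f y \<partial>lborel)"
proof -
  have "(\<integral>\<^sup>+x\<in>seg a b. f (x 0) \<partial>lebd 1) = (\<integral>\<^sup>+x. f (x 0) * indicator {a..<b} (x 0) \<partial>lebd 1)"
    by (intro nn_integral_cong) (simp add: indicator_seg)
  also have "\<dots> = (\<integral>\<^sup>+y\<in>{a..<b}. f y \<partial>lborel)"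
    by (rule nn_integral_lebd1) measurable
  finally show ?thesis .
qed

lemma set_integrable_seg:
  fixes u :: "real \<Rightarrow> real"
  assumes [measurable]: "u \<in> borel_measurable borel"
  shows "set_integrable (lebd 1) (seg a b) (\<lambda>x. u (x 0)) \<longleftrightarrow> set_integrable lborel {a..<b} u"
proof -
  have "set_integrable (lebd 1) (seg a b) (\<lambda>x. u (x 0)) \<longleftrightarrow>
      integrable (lebd 1) (\<lambda>x. indicator {a..<b} (x 0) *\<^sub>R u (x 0))"
    unfolding set_integrable_def by (intro Bochner_Integration.integrable_cong) (auto simp: indicator_seg)
  also have "\<dots> \<longleftrightarrow> integrable (distr (lebd 1) borel (\<lambda>x. x 0)) (\<lambda>y. indicator {a..<b} y *\<^sub>R u y)"
    by (rule integrable_distr_eq[symmetric]) measurable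
  finally show ?thesis by (simp add: distr_lebd1 set_integrable_def)
qed

lemma set_integral_seg:
  fixes u :: "real \<Rightarrow> real"
  assumes [measurable]: "u \<in> borel_measurable borel"
  shows "(LINT x:seg a b|lebd 1. u (x 0)) = (LBINT y:{a..<b}. u y)"
proof -
  have "(LINT x:seg a b|lebd 1. u (x 0)) =
      (LINT x|lebd 1. indicator {a..<b} (x 0) *\<^sub>R u (x 0))"
    unfolding set_lebesgue_integral_def
    by (intro Bochner_Integration.integral_cong) (auto simp: indicator_seg)
  also have "\<dots> = (LINT y|distr (lebd 1) borel (\<lambda>x. x 0). indicator {a..<b} y *\<^sub>R u y)"
    by (rule integral_distr[symmetric]) measurable
  finally show ?thesis by (simp add: distr_lebd1 set_lebesgue_integral_def)
qed

lemma seg_sets: "seg a b \<in> sets (lebd 1)"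
proof -
  have "seg a b \<subseteq> space (lebd 1)" by (auto simp: seg_def space_lebd1 PiE_iff)
  hence "seg a b = (\<lambda>x. x 0) -` {a..<b} \<inter> space (lebd 1)"
    using mem_seg_iff[of _ a b] by blast
  also have "\<dots> \<in> sets (lebd 1)" by measurable
  finally show ?thesis .
qed

lemma emeasure_seg: "a \<le> b \<Longrightarrow> emeasure (lebd 1) (seg a b) = ennreal (b - a)"
  using nn_integral_seg[of "\<lambda>_. 1" a b] nn_integral_indicator[OF seg_sets[of a b]] by simp

lemma average_seg:
  fixes u :: "real \<Rightarrow> real"
  assumes "u \<in> borel_measurable borel" "a < b"
  shows "average 1 (\<lambda>x. u (x 0)) (seg a b) = avg u a b"
  using assms emeasure_seg[of a b]
  unfolding average_def avg_def by (simp add: set_integral_seg measure_def)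

section \<open>Weights on the line and bounds for their constants\<close>

text \<open>Stricter than a weight: Borel measurability allows transfer along the coordinate, and
  nonnegativity everywhere makes \<open>ennreal (u y)\<close> faithful. Positivity stays almost
  everywhere because \<open>0 powr s = 0\<close>.\<close>

definition locally_pos_integrable :: "(real \<Rightarrow> real) \<Rightarrow> bool" where
  "locally_pos_integrable u \<longleftrightarrow> u \<in> borel_measurable borel \<and> (\<forall>y. 0 \<le> u y) \<and>
     (AE y in lborel. 0 < u y) \<and> (\<forall>a b. set_integrable lborel {a..<b} u)"

lemma is_weight_lift:
  assumes "locally_pos_integrable u"
  shows "is_weight 1 (\<lambda>x. u (x 0))"
proof -
  have [measurable]: "u \<in> borel_measurable borel"
    using assms by (simp add: locally_pos_integrable_def)
  have "set_integrable (lebd 1) Q (\<lambda>x. u (x 0))" if "Q \<in> cubes 1" for Q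
    using that assms unfolding cubes_1 locally_pos_integrable_def
    by (auto simp: set_integrable_seg)
  moreover have "AE x in lebd 1. 0 < u (x 0)"
    using assms by (intro AE_lebd1) (simp add: locally_pos_integrable_def)
  moreover have "(\<lambda>x. u (x 0)) \<in> borel_measurable (lebd 1)" by measurable
  ultimately show ?thesis unfolding is_weight_def by blast
qed

text \<open>A vanishing integral of a nonnegative function would make it zero almost everywhere on
  the interval, which would then be a null set.\<close>

lemma set_integral_pos:
  assumes u: "locally_pos_integrable u" and "a < b"
  shows "(LBINT y:{a..<b}. u y) > 0"
proof -
  have int: "set_integrable lborel {a..<b} u" and AE: "AE y in lborel. 0 < u y"
    and nn: "\<And>y. 0 \<le> u y"
    using u by (auto simp: locally_pos_integrable_def)
  have "(LBINT y:{a..<b}. u y) \<noteq> 0"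
  proof
    assume "(LBINT y:{a..<b}. u y) = 0"
    hence "AE y in lborel. indicator {a..<b} y *\<^sub>R u y = 0"
      using integral_nonneg_eq_0_iff_AE[of lborel "\<lambda>y. indicator {a..<b} y *\<^sub>R u y"] int nn
      by (simp add: set_integrable_def set_lebesgue_integral_def)
    with AE have "AE y in lborel. y \<notin> {a..<b}"
      by eventually_elim (auto simp: indicator_def)
    hence "emeasure lborel {a..<b} = 0"
      by (subst (asm) AE_iff_measurable[of "{a..<b}"]) auto
    thus False using \<open>a < b\<close> by simp
  qed
  moreover have "(LBINT y:{a..<b}. u y) \<ge> 0"
    using nn unfolding set_lebesgue_integral_def by (intro integral_nonneg_AE) auto
  ultimately show ?thesis by simp
qed

lemma avg_pos: "locally_pos_integrable u \<Longrightarrow> a < b \<Longrightarrow> avg u a b > 0"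
  by (simp add: avg_def set_integral_pos)

lemma nn_set_integral_eq:
  assumes "locally_pos_integrable u"
  shows "(\<integral>\<^sup>+y\<in>{a..<b}. ennreal (u y) \<partial>lborel) = ennreal (LBINT y:{a..<b}. u y)"
proof -
  have "(\<integral>\<^sup>+y\<in>{a..<b}. ennreal (u y) \<partial>lborel) =
      (\<integral>\<^sup>+y. ennreal (indicator {a..<b} y *\<^sub>R u y) \<partial>lborel)"
    by (intro nn_integral_cong) (simp add: indicator_def)
  also have "\<dots> = ennreal (LBINT y:{a..<b}. u y)"
    unfolding set_lebesgue_integral_def using assms
    by (intro nn_integral_eq_integral) (auto simp: locally_pos_integrable_def set_integrable_def)
  finally show ?thesis .
qed

text \<open>On the unit interval the local maximal function dominates the average over the whole
  interval. The bound places the constant in the domain \<open>{1..}\<close> of the growth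
  functions.\<close>

lemma A_infty_ge_1:
  assumes u: "locally_pos_integrable u"
  shows "A_infty 1 (\<lambda>x. u (x 0)) \<ge> 1"
proof -
  have [measurable]: "u \<in> borel_measurable borel"
    using u by (simp add: locally_pos_integrable_def)
  let ?U = "\<lambda>x::nat\<Rightarrow>real. u (x 0)" and ?Q = "seg 0 1"
  have Q: "?Q \<in> cubes 1" unfolding cubes_1 using zero_less_one by blast
  define I where "I = (LBINT y:{0..<1}. u y)"
  have I: "I > 0" unfolding I_def by (rule set_integral_pos[OF u]) simp
  have "ennreal I = (\<integral>\<^sup>+x\<in>?Q. ennreal (average 1 ?U ?Q) \<partial>lebd 1)"
    by (subst average_seg) (simp_all add: avg_def I_def nn_integral_cmult_indicator seg_sets emeasure_seg)
  also have "\<dots> \<le> (\<integral>\<^sup>+x\<in>?Q. local_max 1 ?Q ?U x \<partial>lebd 1)"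
    unfolding local_max_def using Q
    by (intro nn_integral_mono) (auto simp: indicator_def intro!: SUP_upper2[of ?Q])
  finally have le: "ennreal I \<le> (\<integral>\<^sup>+x\<in>?Q. local_max 1 ?Q ?U x \<partial>lebd 1)" .
  have "1 = ennreal I / ennreal I" using I by simp
  also have "\<dots> \<le> (\<integral>\<^sup>+x\<in>?Q. local_max 1 ?Q ?U x \<partial>lebd 1) / ennreal I"
    using le by (rule divide_right_mono_ennreal)
  also have "\<dots> \<le> A_infty 1 ?U"
    unfolding A_infty_def using Q
    by (intro SUP_upper2[of ?Q]) (simp_all add: I_def set_integral_seg)
  finally show ?thesis .
qed

text \<open>Integrating a majorant of the local maximal function bounds the constant. The majorant
  \<open>h a b\<close> may depend on the interval and has to dominate only almost everywhere, so
  that the origin can be discarded.\<close>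

lemma A_infty_le:
  assumes u: "locally_pos_integrable u" and K: "K \<ge> 0"
    and h [measurable]: "\<And>a b. h a b \<in> borel_measurable borel"
    and maj: "\<And>a b. a < b \<Longrightarrow> AE y in lborel. \<forall>c d. a \<le> c \<longrightarrow> d \<le> b \<longrightarrow> y \<in> {c..<d} \<longrightarrow> ennreal (avg u c d) \<le> h a b y"
    and int: "\<And>a b. a < b \<Longrightarrow> (\<integral>\<^sup>+y\<in>{a..<b}. h a b y \<partial>lborel) \<le> ennreal (K * (LBINT y:{a..<b}. u y))"
  shows "A_infty 1 (\<lambda>x. u (x 0)) \<le> ennreal K"
  unfolding A_infty_def
proof (rule SUP_least)
  have [measurable]: "u \<in> borel_measurable borel"
    using u by (simp add: locally_pos_integrable_def)
  fix Q assume "Q \<in> cubes 1"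
  then obtain a b where Q: "Q = seg a b" and ab: "a < b" unfolding cubes_1 by auto
  define I where "I = (LBINT y:{a..<b}. u y)"
  have I: "I > 0" unfolding I_def by (rule set_integral_pos[OF u ab])
  have "(\<integral>\<^sup>+x\<in>Q. local_max 1 Q (\<lambda>x. u (x 0)) x \<partial>lebd 1) \<le> (\<integral>\<^sup>+x\<in>seg a b. h a b (x 0) \<partial>lebd 1)"
  proof (rule nn_integral_mono_AE)
    show "AE x in lebd 1. local_max 1 Q (\<lambda>x. u (x 0)) x * indicator Q x \<le> h a b (x 0) * indicator (seg a b) x"
      using AE_lebd1[OF maj[OF ab]] AE_space
    proof eventually_elim
      case (elim x)
      have "local_max 1 Q (\<lambda>x. u (x 0)) x \<le> h a b (x 0)" unfolding local_max_def
      proof (rule SUP_least)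
        fix R assume "R \<in> {R \<in> cubes 1. R \<subseteq> Q \<and> x \<in> R}"
        then obtain c d where R: "R = seg c d" and cd: "c < d" and sub: "seg c d \<subseteq> seg a b"
          and x: "x \<in> seg c d" unfolding cubes_1 Q by auto
        have "a \<le> c" "d \<le> b" using sub cd by (auto simp: seg_subset_iff)
        moreover have "x 0 \<in> {c..<d}" using x elim by (simp only: mem_seg_iff)
        ultimately show "ennreal (average 1 (\<lambda>x. u (x 0)) R) \<le> h a b (x 0)"
          unfolding R using elim(1) cd by (simp add: average_seg)
      qed
      thus ?case by (simp add: Q mult_right_mono)
    qed
  qed
  also have "\<dots> = (\<integral>\<^sup>+y\<in>{a..<b}. h a b y \<partial>lborel)" by (rule nn_integral_seg) measurable
  also have "\<dots> \<le> ennreal (K * I)" unfolding I_def by (rule int[OF ab])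
  finally have "(\<integral>\<^sup>+x\<in>Q. local_max 1 Q (\<lambda>x. u (x 0)) x \<partial>lebd 1) / ennreal I \<le> ennreal (K * I) / ennreal I"
    by (rule divide_right_mono_ennreal)
  also have "\<dots> = ennreal K" using I K by (simp add: divide_ennreal)
  finally show "(\<integral>\<^sup>+x\<in>Q. local_max 1 Q (\<lambda>x. u (x 0)) x \<partial>lebd 1) / ennreal (LINT x:Q|lebd 1. u (x 0)) \<le> ennreal K"
    unfolding Q I_def by (subst set_integral_seg) auto
qed

lemma A_p_le:
  assumes [measurable]: "w \<in> borel_measurable borel" "\<sigma> \<in> borel_measurable borel"
    and "\<And>a b. a < b \<Longrightarrow> avg w a b * avg \<sigma> a b powr (p - 1) \<le> K"
  shows "A_p 1 p (\<lambda>x. w (x 0)) (\<lambda>x. \<sigma> (x 0)) \<le> ennreal K"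
  unfolding A_p_def
proof (rule SUP_least)
  fix Q assume "Q \<in> cubes 1"
  then obtain a b where Q: "Q = seg a b" and ab: "a < b" unfolding cubes_1 by auto
  show "ennreal (average 1 (\<lambda>x. w (x 0)) Q * average 1 (\<lambda>x. \<sigma> (x 0)) Q powr (p - 1)) \<le> ennreal K"
    unfolding Q using assms(3)[OF ab] by (simp add: average_seg ab ennreal_leI)
qed

section \<open>The square function on initial dyadic intervals\<close>

lemma dyadic_1:
  "dyadic 1 = {seg (of_int k * 2 powi (-n)) ((of_int k + 1) * 2 powi (-n)) | n k. True}"
proof -
  have "(\<Pi>\<^sub>E i\<in>{..<1::nat}. {of_int (k i) * 2 powi (-n)..<(of_int (k i) + 1) * 2 powi (-n)}) =
      seg (of_int (k 0) * 2 powi (-n)) ((of_int (k 0) + 1) * 2 powi (-n))"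
    for k :: "nat \<Rightarrow> int" and n :: int
    unfolding seg_def by (intro PiE_cong) auto
  thus ?thesis
    unfolding dyadic_def by (auto intro: exI[of _ "\<lambda>_. _"])
qed

lemma half_power_powi: "(1/2::real) ^ j = 2 powi (- int j)"
  by (simp add: power_int_minus power_one_over inverse_eq_divide)

lemma dyadic_segI:
  assumes "a = of_int k * (1/2) ^ j" "b = (of_int k + 1) * (1/2) ^ j"
  shows "seg a b \<in> dyadic 1"
  unfolding dyadic_1 assms half_power_powi by blast

lemma dyadic_initial: "seg 0 ((1/2) ^ j) \<in> dyadic 1"
  by (rule dyadic_segI[of _ 0 j]) simp_all

lemma dyadic_upper_half: "seg ((1/2) ^ Suc j) ((1/2) ^ j) \<in> dyadic 1"
  by (rule dyadic_segI[of _ 1 "Suc j"]) simp_all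

text \<open>A dyadic interval strictly inside \<open>[0, (1/2) ^ j)\<close> has length
  \<open>r\<close> at most \<open>(1/2) ^ Suc j\<close>. The midpoint is then an integer multiple
  \<open>2 ^ m * r\<close>, as are both endpoints, so it cannot fall in the interior.\<close>

lemma dyadic_psubset_initial:
  assumes R: "R \<in> dyadic 1" and sub: "R \<subset> seg 0 ((1/2) ^ j)"
  shows "R \<subseteq> seg 0 ((1/2) ^ Suc j) \<or> R \<subseteq> seg ((1/2) ^ Suc j) ((1/2) ^ j)"
proof -
  obtain n k where Req: "R = seg (of_int k * 2 powi (-n)) ((of_int k + 1) * 2 powi (-n))"
    using R unfolding dyadic_1 by auto
  define r :: real where "r = 2 powi (-n)"
  have r: "r > 0" by (simp add: r_def)
  have lt: "of_int k * r < (of_int k + 1) * r" using r by simp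
  have *: "0 \<le> of_int k * r" "(of_int k + 1) * r \<le> (1/2) ^ j"
    "\<not> (of_int k * r \<le> 0 \<and> (1/2) ^ j \<le> (of_int k + 1) * r)"
    using sub seg_psubset_iff[OF lt, of 0 "(1/2)^j"] unfolding Req r_def by simp_all
  have k: "k \<ge> 0" using *(1) r by (simp add: zero_le_mult_iff)
  have "r \<le> (of_int k + 1) * r" using k r by simp
  hence "r \<le> (1/2) ^ j" using *(2) by linarith
  hence nj: "n \<ge> int j"
    unfolding r_def half_power_powi
    using power_int_strict_increasing[of "- int j" "- n" "2::real"] by (cases "n < int j") auto
  have "n \<noteq> int j"
  proof
    assume "n = int j"
    hence rj: "r = (1/2) ^ j" by (simp add: r_def half_power_powi)
    have "k = 0" using *(2) k r unfolding rj by simp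
    thus False using *(3) rj by simp
  qed
  with nj obtain m where m: "n = int (Suc j + m)"
    by (metis Suc_leI int_ops(5) le_iff_add nat_int of_nat_less_iff order_le_less zle_iff_zadd
        of_nat_Suc zless_imp_add1_zle add.commute)
  have half: "(1/2) ^ Suc j = of_int (2 ^ m) * r"
    unfolding r_def m half_power_powi[symmetric] by (simp add: power_add field_simps)
  show ?thesis
  proof (cases "k + 1 \<le> 2 ^ m")
    case True
    hence "(of_int k + 1 :: real) \<le> of_int (2 ^ m)" by linarith
    hence "(of_int k + 1) * r \<le> (1/2) ^ Suc j"
      unfolding half using r by (intro mult_right_mono) auto
    thus ?thesis using *(1) lt unfolding Req r_def[symmetric] by (simp add: seg_subset_iff)
  next
    case False
    hence "(of_int (2 ^ m) :: real) \<le> of_int k" by linarith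
    hence "(1/2) ^ Suc j \<le> of_int k * r"
      unfolding half using r by (intro mult_right_mono) auto
    thus ?thesis using *(2) lt unfolding Req r_def[symmetric] by (simp add: seg_subset_iff del: power_Suc)
  qed
qed

text \<open>By the dichotomy for strict dyadic subintervals, everything dyadic strictly inside the
  parent lies in one of its halves. A half is maximal because neither half contains the
  other.\<close>

lemma children_initial:
  "children 1 (seg 0 ((1/2) ^ j)) = {seg 0 ((1/2) ^ Suc j), seg ((1/2) ^ Suc j) ((1/2) ^ j)}"
    (is "children 1 ?Q = {?L, ?R}")
proof -
  have pos: "(0::real) < (1/2) ^ Suc j" "(1/2::real) ^ Suc j < (1/2) ^ j" "(0::real) < (1/2)^j"
    by simp_all
  have LQ: "?L \<subset> ?Q" and RQ: "?R \<subset> ?Q"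
    unfolding seg_psubset_iff[OF pos(1,3)] seg_psubset_iff[OF pos(2,3)] using pos by linarith+
  have nLR: "\<not> ?L \<subseteq> ?R" "\<not> ?R \<subseteq> ?L"
    unfolding seg_subset_iff[OF pos(1)] seg_subset_iff[OF pos(2)] using pos by linarith+
  have D: "?L \<in> dyadic 1" "?R \<in> dyadic 1" by (rule dyadic_initial dyadic_upper_half)+
  have sub: "R \<subseteq> ?L \<or> R \<subseteq> ?R" if "R \<in> dyadic 1" "R \<subset> ?Q" for R
    using dyadic_psubset_initial[OF that] .
  show ?thesis
  proof (intro equalityI subsetI)
    fix R assume R: "R \<in> children 1 ?Q"
    hence RD: "R \<in> dyadic 1" "R \<subset> ?Q"
      and max: "\<And>R'. R' \<in> dyadic 1 \<Longrightarrow> R \<subset> R' \<Longrightarrow> \<not> R' \<subset> ?Q"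
      unfolding children_def by auto
    show "R \<in> {?L, ?R}"
      using sub[OF RD] max[OF D(1)] max[OF D(2)] LQ RQ by blast
  next
    fix R assume "R \<in> {?L, ?R}"
    hence R: "R \<in> dyadic 1" "R \<subset> ?Q" using D LQ RQ by auto
    have "\<not> R' \<subset> ?Q" if "R' \<in> dyadic 1" "R \<subset> R'" for R'
    proof
      assume "R' \<subset> ?Q"
      from sub[OF that(1) this] \<open>R \<in> {?L, ?R}\<close> \<open>R \<subset> R'\<close> nLR show False by blast
    qed
    with R show "R \<in> children 1 ?Q" unfolding children_def by blast
  qed
qed

lemma mart_diff_initial:
  assumes [measurable]: "u \<in> borel_measurable borel" and x: "x \<in> space (lebd 1)"
  shows "x 0 \<in> {0..<(1/2) ^ Suc j} \<Longrightarrow> mart_diff 1 (seg 0 ((1/2) ^ j)) (\<lambda>x. u (x 0)) x =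
      avg u 0 ((1/2) ^ Suc j) - avg u 0 ((1/2) ^ j)" (is "?A \<Longrightarrow> ?A'")
    and "x 0 \<in> {(1/2) ^ Suc j..<(1/2) ^ j} \<Longrightarrow> mart_diff 1 (seg 0 ((1/2) ^ j)) (\<lambda>x. u (x 0)) x =
      avg u ((1/2) ^ Suc j) ((1/2) ^ j) - avg u 0 ((1/2) ^ j)" (is "?B \<Longrightarrow> ?B'")
proof -
  have pos: "(0::real) < (1/2) ^ Suc j" "(1/2::real) ^ Suc j < (1/2) ^ j" "(0::real) < (1/2)^j"
    by simp_all
  \<comment> \<open>The children must be distinct sets for the sum over them to have two
    terms.\<close>
  have "seg 0 ((1/2) ^ Suc j) \<noteq> seg ((1/2) ^ Suc j) ((1/2) ^ j)"
    using seg_subset_iff[OF pos(1), of "(1/2) ^ Suc j" "(1/2) ^ j"] pos by auto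
  hence eq: "mart_diff 1 (seg 0 ((1/2) ^ j)) (\<lambda>x. u (x 0)) x =
     avg u 0 ((1/2) ^ Suc j) * indicator {0..<(1/2) ^ Suc j} (x 0)
     + avg u ((1/2) ^ Suc j) ((1/2) ^ j) * indicator {(1/2) ^ Suc j..<(1/2) ^ j} (x 0)
     - avg u 0 ((1/2) ^ j) * indicator {0..<(1/2) ^ j} (x 0)"
    unfolding mart_diff_def children_initial using pos x
    by (simp add: average_seg indicator_seg del: power_Suc sum_mult_indicator)
  show "?A \<Longrightarrow> ?A'" "?B \<Longrightarrow> ?B'"
    unfolding eq using pos less_trans[OF _ pos(2), of "x 0"] order_trans[OF less_imp_le[OF pos(1)], of "x 0"]
    by (auto simp: indicator_def simp del: power_Suc)
qed

section \<open>Powers in \<open>[0,\<infinity>]\<close> and lower bounds for norms\<close>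

lemma epowr_ennreal: "0 \<le> a \<Longrightarrow> epowr (ennreal a) r = ennreal (a powr r)"
  by (simp add: epowr_def)

lemma epowr_mono:
  assumes "s \<le> t" "0 \<le> r"
  shows "epowr s r \<le> epowr t r"
proof (cases "t = \<infinity>")
  case False
  hence "t < top" by (simp add: less_top)
  with assms show ?thesis
    by (auto simp: epowr_def intro!: ennreal_leI powr_mono2 enn2real_mono)
qed (simp add: epowr_def)

text \<open>All terms are nonnegative, so the sum over all dyadic cubes dominates every finite
  partial sum.\<close>

lemma square_fun_ge:
  assumes "finite F" "F \<subseteq> dyadic d" "0 \<le> c" "c\<^sup>2 \<le> (\<Sum>Q\<in>F. (mart_diff d Q f x)\<^sup>2)"
  shows "ennreal c \<le> square_fun d f x"
proof -
  have "ennreal c = epowr (ennreal (c\<^sup>2)) (1/2)"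
    using \<open>0 \<le> c\<close> by (simp add: epowr_ennreal powr_half_sqrt)
  also have "ennreal (c\<^sup>2) \<le> (\<Sum>Q\<in>F. ennreal ((mart_diff d Q f x)\<^sup>2))"
    using assms(4) by (subst sum_ennreal) (auto intro: ennreal_leI)
  also have "\<dots> \<le> (\<Sum>\<^sub>\<infinity>Q\<in>dyadic d. ennreal ((mart_diff d Q f x)\<^sup>2))"
    using assms(1,2) by (subst nonneg_infsum_complete) (auto intro: SUP_upper)
  finally show ?thesis unfolding square_fun_def by (simp add: epowr_mono)
qed

lemma Lp_norm_mono:
  assumes "0 \<le> p" "\<And>x. x \<in> space M \<Longrightarrow> g x \<le> h x"
  shows "Lp_norm p M g \<le> Lp_norm p M h"
  unfolding Lp_norm_def using assms
  by (intro epowr_mono nn_integral_mono) auto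

lemma S_norm_ge:
  assumes "f \<in> borel_measurable (weighted d \<sigma>)"
    and f: "Lp_norm p (weighted d \<sigma>) (\<lambda>x. ennreal \<bar>f x\<bar>) \<le> ennreal N" "N > 0"
    and S: "ennreal (L * N) \<le> Lp_norm p (weighted d w) (square_fun d (\<lambda>x. f x * \<sigma> x))"
  shows "ennreal L \<le> S_norm d p w \<sigma>"
  unfolding S_norm_def
proof (rule Inf_greatest, clarify)
  fix C assume C: "\<forall>f\<in>Lp p (weighted d \<sigma>). Lp_norm p (weighted d w) (square_fun d (\<lambda>x. f x * \<sigma> x))
     \<le> C * Lp_norm p (weighted d \<sigma>) (\<lambda>x. ennreal \<bar>f x\<bar>)"
  have "f \<in> Lp p (weighted d \<sigma>)"
    unfolding Lp_def using assms(1) f le_less_trans[OF f(1) ennreal_less_top] by simp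
  hence "Lp_norm p (weighted d w) (square_fun d (\<lambda>x. f x * \<sigma> x))
     \<le> C * Lp_norm p (weighted d \<sigma>) (\<lambda>x. ennreal \<bar>f x\<bar>)" using C by blast
  also have "\<dots> \<le> C * ennreal N" using f(1) by (rule mult_left_mono) simp
  finally have le: "ennreal (L * N) \<le> C * ennreal N" using S by order
  show "ennreal L \<le> C"
  proof (cases "C = top \<or> L \<le> 0")
    case True
    thus ?thesis by (auto simp: ennreal_neg)
  next
    case False
    then obtain c where c: "C = ennreal c" "c \<ge> 0" using ennreal_cases[of C] by auto
    have "L * N \<le> c * N" using le f(2) c False by (simp add: ennreal_mult[symmetric] del: ennreal_mult)
    thus ?thesis using f(2) c by (simp add: ennreal_leI)
  qed
qed

section \<open>Power weights\<close>

lemma avg_le: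
  assumes u: "locally_pos_integrable u" and "a < b" and le: "\<And>y. y \<in> {a..<b} \<Longrightarrow> u y \<le> M"
  shows "avg u a b \<le> M"
proof -
  have "(LBINT y:{a..<b}. u y) \<le> (LBINT y:{a..<b}. M)"
    using u le \<open>a < b\<close>
    by (intro set_integral_mono) (auto simp: locally_pos_integrable_def set_integrable_def)
  also have "\<dots> = M * (b - a)"
    using \<open>a < b\<close> by (simp add: set_lebesgue_integral_def)
  finally show ?thesis using \<open>a < b\<close> by (simp add: avg_def field_simps)
qed

lemma set_integral_mono_interval:
  assumes u: "locally_pos_integrable u" and "c \<le> a" "b \<le> d"
  shows "(LBINT y:{a..<b}. u y) \<le> (LBINT y:{c..<d}. u y)"
  unfolding set_lebesgue_integral_def
proof (rule integral_mono)
  show "integrable lborel (\<lambda>x. indicat_real {a..<b} x *\<^sub>R u x)"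
    "integrable lborel (\<lambda>x. indicat_real {c..<d} x *\<^sub>R u x)"
    using u by (auto simp: locally_pos_integrable_def set_integrable_def)
  show "indicat_real {a..<b} x *\<^sub>R u x \<le> indicat_real {c..<d} x *\<^sub>R u x" for x
    using u assms(2,3) by (auto simp: locally_pos_integrable_def indicator_def)
qed

text \<open>The singularity at the origin is integrable since \<open>s > -1\<close>. The closed
  interval, where the integral is known, differs from the half-open one by a null set.\<close>

lemma nn_integral_power_0:
  fixes s c :: real
  assumes "s > -1" "c \<ge> 0"
  shows "(\<integral>\<^sup>+y\<in>{0..<c}. ennreal (\<bar>y\<bar> powr s) \<partial>lborel) = ennreal (c powr (s + 1) / (s + 1))"
proof -
  have "((\<lambda>y. \<bar>y\<bar> powr s) has_integral c powr (s + 1) / (s + 1)) {0..c}"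
    using has_integral_powr_from_0[OF assms] by (rule has_integral_eq_rhs[OF has_integral_eq, rotated]) auto
  hence "(\<integral>\<^sup>+y\<in>{0..c}. ennreal (\<bar>y\<bar> powr s) \<partial>lborel) = ennreal (c powr (s + 1) / (s + 1))"
    by (intro nn_integral_has_integral_lebesgue') auto
  moreover have "(\<integral>\<^sup>+y\<in>{0..<c}. ennreal (\<bar>y\<bar> powr s) \<partial>lborel) = (\<integral>\<^sup>+y\<in>{0..c}. ennreal (\<bar>y\<bar> powr s) \<partial>lborel)"
  proof (rule nn_integral_cong_AE)
    show "AE y in lborel. ennreal (\<bar>y\<bar> powr s) * indicator {0..<c} y = ennreal (\<bar>y\<bar> powr s) * indicator {0..c} y"
      using AE_lborel_singleton[of c] by eventually_elim (auto simp: indicator_def)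
  qed
  ultimately show ?thesis by simp
qed

text \<open>Reflection in the origin maps the negative half to the positive one up to the null set
  formed by \<open>0\<close> and \<open>c\<close>.\<close>

lemma nn_integral_power_symmetric:
  fixes s c :: real
  assumes "s > -1" "c \<ge> 0"
  shows "(\<integral>\<^sup>+y\<in>{-c..<c}. ennreal (\<bar>y\<bar> powr s) \<partial>lborel) = ennreal (2 * c powr (s + 1) / (s + 1))"
proof -
  have "(\<integral>\<^sup>+y\<in>{-c..<0}. ennreal (\<bar>y\<bar> powr s) \<partial>lborel) =
      (\<integral>\<^sup>+y. ennreal (\<bar>- y\<bar> powr s) * indicator {-c..<0} (- y) \<partial>lborel)"
    using nn_integral_real_affine[of "\<lambda>y. ennreal (\<bar>y\<bar> powr s) * indicator {-c..<0} y" "-1" 0] by simp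
  also have "\<dots> = (\<integral>\<^sup>+y\<in>{0..<c}. ennreal (\<bar>y\<bar> powr s) \<partial>lborel)"
  proof (rule nn_integral_cong_AE)
    show "AE y in lborel. ennreal (\<bar>- y\<bar> powr s) * indicator {-c..<0} (- y) =
        ennreal (\<bar>y\<bar> powr s) * indicator {0..<c} y"
      using AE_lborel_singleton[of c] AE_lborel_singleton[of 0]
      by eventually_elim (auto simp: indicator_def)
  qed
  also have "\<dots> = ennreal (c powr (s + 1) / (s + 1))" by (rule nn_integral_power_0[OF assms])
  finally have neg: "(\<integral>\<^sup>+y\<in>{-c..<0}. ennreal (\<bar>y\<bar> powr s) \<partial>lborel) = ennreal (c powr (s + 1) / (s + 1))" .
  have "(\<integral>\<^sup>+y\<in>{-c..<c}. ennreal (\<bar>y\<bar> powr s) \<partial>lborel) =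
      (\<integral>\<^sup>+y. ennreal (\<bar>y\<bar> powr s) * indicator {-c..<0} y + ennreal (\<bar>y\<bar> powr s) * indicator {0..<c} y \<partial>lborel)"
    using assms by (intro nn_integral_cong) (auto simp: indicator_def)
  also have "\<dots> = ennreal (c powr (s + 1) / (s + 1)) + ennreal (c powr (s + 1) / (s + 1))"
    by (subst nn_integral_add) (simp_all add: neg nn_integral_power_0[OF assms])
  also have "\<dots> = ennreal (2 * c powr (s + 1) / (s + 1))"
    using assms by (simp add: ennreal_plus[symmetric] del: ennreal_plus)
  finally show ?thesis .
qed

text \<open>Every interval lies in a symmetric one, on which the integral is explicit and
  finite.\<close>

lemma power_locally_pos_integrable:
  assumes "s > -1"
  shows "locally_pos_integrable (\<lambda>y. \<bar>y\<bar> powr s)"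
  unfolding locally_pos_integrable_def
proof (intro conjI allI)
  show "AE y::real in lborel. 0 < \<bar>y\<bar> powr s"
    using AE_lborel_singleton[of 0] by eventually_elim auto
  fix a b :: real
  define c where "c = max \<bar>a\<bar> \<bar>b\<bar>"
  have "set_integrable lborel {-c..<c} (\<lambda>y. \<bar>y\<bar> powr s)"
    unfolding set_integrable_def
  proof (rule integrableI_nonneg)
    have "(\<integral>\<^sup>+y. ennreal (indicat_real {-c..<c} y *\<^sub>R \<bar>y\<bar> powr s) \<partial>lborel) =
        (\<integral>\<^sup>+y\<in>{-c..<c}. ennreal (\<bar>y\<bar> powr s) \<partial>lborel)"
      by (intro nn_integral_cong) (simp add: indicator_def)
    thus "(\<integral>\<^sup>+y. ennreal (indicat_real {-c..<c} y *\<^sub>R \<bar>y\<bar> powr s) \<partial>lborel) < \<infinity>"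
      by (subst (asm) nn_integral_power_symmetric[OF assms]) (auto simp: c_def)
  qed auto
  thus "set_integrable lborel {a..<b} (\<lambda>y. \<bar>y\<bar> powr s)"
    by (rule set_integrable_subset) (auto simp: c_def)
qed auto

lemma set_integral_power_0:
  fixes s c :: real
  assumes "s > -1" "c \<ge> 0"
  shows "(LBINT y:{0..<c}. \<bar>y\<bar> powr s) = c powr (s + 1) / (s + 1)"
  using nn_integral_power_0[OF assms] assms
  unfolding nn_set_integral_eq[OF power_locally_pos_integrable[OF assms(1)]]
  by (subst (asm) ennreal_inj) (auto simp: set_lebesgue_integral_def intro!: integral_nonneg_AE)

lemma set_integral_power_symmetric:
  fixes s c :: real
  assumes "s > -1" "c \<ge> 0"
  shows "(LBINT y:{-c..<c}. \<bar>y\<bar> powr s) = 2 * c powr (s + 1) / (s + 1)"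
  using nn_integral_power_symmetric[OF assms] assms
  unfolding nn_set_integral_eq[OF power_locally_pos_integrable[OF assms(1)]]
  by (subst (asm) ennreal_inj) (auto simp: set_lebesgue_integral_def intro!: integral_nonneg_AE)

text \<open>An interval that is long compared with its distance from the origin is enlarged to a
  symmetric one; on a short interval the power is nearly constant.\<close>

lemma avg_negative_power_le:
  fixes t a b :: real
  assumes "0 < t" "t \<le> 1" "a < b"
  shows "avg (\<lambda>y. \<bar>y\<bar> powr (t - 1)) a b \<le> 4 / t * max \<bar>a\<bar> \<bar>b\<bar> powr (t - 1)"
proof -
  define m where "m = max \<bar>a\<bar> \<bar>b\<bar>"
  have m: "m > 0" using assms by (auto simp: m_def)
  have s: "t - 1 > -1" using assms by simp
  note lpi = power_locally_pos_integrable[OF s]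
  show ?thesis
  proof (cases "m / 2 \<le> b - a")
    case True
    have "(LBINT y:{a..<b}. \<bar>y\<bar> powr (t - 1)) \<le> (LBINT y:{-m..<m}. \<bar>y\<bar> powr (t - 1))"
      by (rule set_integral_mono_interval[OF lpi]) (auto simp: m_def)
    also have "\<dots> = 2 * m powr t / t"
      using set_integral_power_symmetric[OF s, of m] m by simp
    finally have "avg (\<lambda>y. \<bar>y\<bar> powr (t - 1)) a b \<le> (2 * m powr t / t) / (b - a)"
      using \<open>a < b\<close> unfolding avg_def by (intro divide_right_mono) auto
    also have "\<dots> \<le> (2 * m powr t / t) / (m / 2)"
      using True m \<open>0 < t\<close> by (intro divide_left_mono) auto
    also have "\<dots> = 4 / t * m powr (t - 1)"
      using m by (simp add: powr_diff)
    finally show ?thesis unfolding m_def .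
  next
    case False
    have "avg (\<lambda>y. \<bar>y\<bar> powr (t - 1)) a b \<le> (m / 2) powr (t - 1)"
    proof (rule avg_le[OF lpi \<open>a < b\<close>])
      fix y assume "y \<in> {a..<b}"
      \<comment> \<open>The whole interval is closer than \<open>m / 2\<close> to its endpoint of
        modulus \<open>m\<close>.\<close>
      hence "m / 2 \<le> \<bar>y\<bar>" using False unfolding m_def by auto
      thus "\<bar>y\<bar> powr (t - 1) \<le> (m / 2) powr (t - 1)"
        using m assms by (intro powr_mono2') auto
    qed
    also have "\<dots> = 2 powr (1 - t) * m powr (t - 1)"
      using m by (simp add: powr_divide powr_diff)
    also have "2 powr (1 - t) \<le> 2 powr (1::real)"
      using assms by (intro powr_mono) auto
    also have "2 powr (1::real) \<le> 4 / t" using assms by (simp add: field_simps)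
    finally show ?thesis unfolding m_def by (simp add: mult_right_mono)
  qed
qed

lemma avg_nonneg_power_le:
  fixes s a b :: real
  assumes "0 \<le> s" "a < b"
  shows "avg (\<lambda>y. \<bar>y\<bar> powr s) a b \<le> max \<bar>a\<bar> \<bar>b\<bar> powr s"
  using assms by (intro avg_le power_locally_pos_integrable powr_mono2) auto

text \<open>On the quarter of the interval next to the endpoint of larger modulus \<open>m\<close>,
  every point has modulus at least \<open>m / 2\<close>; for \<open>a = -b\<close> a larger fraction
  would fail. The quarter costs the factor \<open>4\<close> and the half costs
  \<open>2 powr s\<close>.\<close>

lemma set_integral_nonneg_power_ge:
  fixes s a b :: real
  assumes "0 \<le> s" "a < b"
  shows "(b - a) * max \<bar>a\<bar> \<bar>b\<bar> powr s \<le> 4 * 2 powr s * (LBINT y:{a..<b}. \<bar>y\<bar> powr s)"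
proof -
  define m where "m = max \<bar>a\<bar> \<bar>b\<bar>"
  have m: "m > 0" using assms by (auto simp: m_def)
  have lpi: "locally_pos_integrable (\<lambda>y. \<bar>y\<bar> powr s)"
    using assms by (intro power_locally_pos_integrable) simp
  obtain c where c: "a \<le> c" "c + (b - a) / 4 \<le> b"
    and far: "\<And>y. y \<in> {c..<c + (b - a) / 4} \<Longrightarrow> m / 2 \<le> \<bar>y\<bar>"
  proof (cases "\<bar>a\<bar> \<le> \<bar>b\<bar>")
    case True
    show ?thesis by (rule that[of "b - (b - a) / 4"]) (use True \<open>a < b\<close> in \<open>auto simp: m_def field_simps\<close>)
  next
    case False
    show ?thesis by (rule that[of a]) (use False \<open>a < b\<close> in \<open>auto simp: m_def field_simps\<close>)
  qed
  define d where "d = c + (b - a) / 4"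
  have cd: "c < d" "d - c = (b - a) / 4" using \<open>a < b\<close> by (auto simp: d_def)
  have "(b - a) / 4 * (m / 2) powr s = (LBINT y:{c..<d}. (m / 2) powr s)"
    using cd by (simp add: set_lebesgue_integral_def)
  also have "\<dots> \<le> (LBINT y:{c..<d}. \<bar>y\<bar> powr s)"
    using lpi m far assms cd(1) unfolding d_def[symmetric]
    by (intro set_integral_mono powr_mono2) (auto simp: locally_pos_integrable_def set_integrable_def)
  also have "\<dots> \<le> (LBINT y:{a..<b}. \<bar>y\<bar> powr s)"
    using c by (intro set_integral_mono_interval[OF lpi]) (auto simp: d_def)
  finally show ?thesis using m unfolding m_def[symmetric] by (simp add: powr_divide field_simps)
qed

section \<open>The \<open>A_infty\<close> constants of powers\<close>

text \<open>The power is nonincreasing in \<open>\<bar>y\<bar>\<close>, so its average over any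
  interval around \<open>y\<close> is at most \<open>4 / t\<close> times its value at
  \<open>y\<close>. The origin is excepted, as the power is set to \<open>0\<close> there when
  \<open>t < 1\<close>.\<close>

lemma A_infty_negative_power_le:
  assumes "0 < t" "t \<le> 1"
  shows "A_infty 1 (\<lambda>x. \<bar>x 0\<bar> powr (t - 1)) \<le> ennreal (4 / t)"
proof (rule A_infty_le[where h = "\<lambda>_ _ y. ennreal (4 / t * \<bar>y\<bar> powr (t - 1))" and u = "\<lambda>y. \<bar>y\<bar> powr (t - 1)"])
  have lpi: "locally_pos_integrable (\<lambda>y. \<bar>y\<bar> powr (t - 1))"
    using assms by (intro power_locally_pos_integrable) simp
  show "locally_pos_integrable (\<lambda>y. \<bar>y\<bar> powr (t - 1))" by (rule lpi)
  show "4 / t \<ge> 0" using assms by simp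
  fix a b :: real assume "a < b"
  show "AE y in lborel. \<forall>c d. a \<le> c \<longrightarrow> d \<le> b \<longrightarrow> y \<in> {c..<d} \<longrightarrow>
      ennreal (avg (\<lambda>y. \<bar>y\<bar> powr (t - 1)) c d) \<le> ennreal (4 / t * \<bar>y\<bar> powr (t - 1))"
    using AE_lborel_singleton[of 0]
  proof eventually_elim
    case (elim y)
    show ?case
    proof (intro allI impI ennreal_leI)
      fix c d assume y: "y \<in> {c..<d}"
      have "avg (\<lambda>y. \<bar>y\<bar> powr (t - 1)) c d \<le> 4 / t * max \<bar>c\<bar> \<bar>d\<bar> powr (t - 1)"
        using assms y by (intro avg_negative_power_le) auto
      also have "\<dots> \<le> 4 / t * \<bar>y\<bar> powr (t - 1)"
        using assms y elim by (intro mult_left_mono powr_mono2') auto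
      finally show "avg (\<lambda>y. \<bar>y\<bar> powr (t - 1)) c d \<le> 4 / t * \<bar>y\<bar> powr (t - 1)" .
    qed
  qed
  have "(\<integral>\<^sup>+y\<in>{a..<b}. ennreal (4 / t * \<bar>y\<bar> powr (t - 1)) \<partial>lborel) =
      ennreal (4 / t) * (\<integral>\<^sup>+y\<in>{a..<b}. ennreal (\<bar>y\<bar> powr (t - 1)) \<partial>lborel)"
    using assms
    by (subst nn_integral_cmult[symmetric])
       (auto simp: ennreal_mult[symmetric] indicator_def intro!: nn_integral_cong)
  thus "(\<integral>\<^sup>+y\<in>{a..<b}. ennreal (4 / t * \<bar>y\<bar> powr (t - 1)) \<partial>lborel) \<le>
      ennreal (4 / t * (LBINT y:{a..<b}. \<bar>y\<bar> powr (t - 1)))"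
    using assms less_imp_le[OF set_integral_pos[OF lpi \<open>a < b\<close>]]
    by (simp add: nn_set_integral_eq[OF lpi] ennreal_mult[symmetric])
qed auto

text \<open>On \<open>[a,b)\<close> the local maximal function is at most the constant
  \<open>max \<bar>a\<bar> \<bar>b\<bar> powr s\<close>, and the integral of this constant exceeds
  the mass of the interval by at most the stated factor.\<close>

lemma A_infty_nonneg_power_le:
  assumes "0 \<le> s"
  shows "A_infty 1 (\<lambda>x. \<bar>x 0\<bar> powr s) \<le> ennreal (4 * 2 powr s)"
proof (rule A_infty_le[where h = "\<lambda>a b _. ennreal (max \<bar>a\<bar> \<bar>b\<bar> powr s)" and u = "\<lambda>y. \<bar>y\<bar> powr s"])
  show "locally_pos_integrable (\<lambda>y. \<bar>y\<bar> powr s)"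
    using assms by (intro power_locally_pos_integrable) simp
  fix a b :: real assume "a < b"
  show "AE y in lborel. \<forall>c d. a \<le> c \<longrightarrow> d \<le> b \<longrightarrow> y \<in> {c..<d} \<longrightarrow>
      ennreal (avg (\<lambda>y. \<bar>y\<bar> powr s) c d) \<le> ennreal (max \<bar>a\<bar> \<bar>b\<bar> powr s)"
  proof (intro always_eventually allI impI ennreal_leI)
    fix y c d assume *: "a \<le> c" "d \<le> b" "y \<in> {c..<d}"
    have "avg (\<lambda>y. \<bar>y\<bar> powr s) c d \<le> max \<bar>c\<bar> \<bar>d\<bar> powr s"
      using * assms by (intro avg_nonneg_power_le) auto
    also have "\<dots> \<le> max \<bar>a\<bar> \<bar>b\<bar> powr s"
      using * assms by (intro powr_mono2) auto
    finally show "avg (\<lambda>y. \<bar>y\<bar> powr s) c d \<le> max \<bar>a\<bar> \<bar>b\<bar> powr s" .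
  qed
  show "(\<integral>\<^sup>+y\<in>{a..<b}. ennreal (max \<bar>a\<bar> \<bar>b\<bar> powr s) \<partial>lborel) \<le>
      ennreal (4 * 2 powr s * (LBINT y:{a..<b}. \<bar>y\<bar> powr s))"
    using set_integral_nonneg_power_ge[OF assms \<open>a < b\<close>] \<open>a < b\<close>
    by (subst nn_integral_cmult_indicator)
       (auto simp: ennreal_mult[symmetric] mult.commute intro!: ennreal_leI)
qed auto

section \<open>Test functions\<close>

lemma Lp_norm_weighted_lift:
  fixes w g :: "real \<Rightarrow> real"
  assumes [measurable]: "w \<in> borel_measurable borel" "g \<in> borel_measurable borel"
    and "\<And>y. 0 \<le> w y" "\<And>y. 0 \<le> g y"
  shows "Lp_norm p (weighted 1 (\<lambda>x. w (x 0))) (\<lambda>x. ennreal (g (x 0))) =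
    epowr (\<integral>\<^sup>+y. ennreal (w y * g y powr p) \<partial>lborel) (1 / p)"
proof -
  have "(\<integral>\<^sup>+x. epowr (ennreal (g (x 0))) p \<partial>weighted 1 (\<lambda>x. w (x 0))) =
      (\<integral>\<^sup>+x. ennreal (g (x 0) powr p) \<partial>weighted 1 (\<lambda>x. w (x 0)))"
    using assms by (intro nn_integral_cong) (simp add: epowr_ennreal)
  also have "\<dots> = (\<integral>\<^sup>+x. ennreal (w (x 0)) * ennreal (g (x 0) powr p) \<partial>lebd 1)"
    unfolding weighted_def by (rule nn_integral_density) measurable
  also have "\<dots> = (\<integral>\<^sup>+x. (\<lambda>y. ennreal (w y * g y powr p)) (x 0) \<partial>lebd 1)"
    using assms by (intro nn_integral_cong) (simp add: ennreal_mult)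
  also have "\<dots> = (\<integral>\<^sup>+y. ennreal (w y * g y powr p) \<partial>lborel)"
    by (rule nn_integral_lebd1) measurable
  finally show ?thesis unfolding Lp_norm_def by simp
qed

text \<open>The test-function argument expressed on the line: \<open>N\<close> bounds the
  \<open>p\<close>-th power of the norm of \<open>f\<close>, and \<open>g\<close> is a pointwise
  minorant of the square function, whose exact value is not computed.\<close>

lemma S_norm_lift_ge:
  fixes w \<sigma> f g :: "real \<Rightarrow> real"
  assumes [measurable]: "w \<in> borel_measurable borel" "\<sigma> \<in> borel_measurable borel"
      "f \<in> borel_measurable borel" "g \<in> borel_measurable borel"
    and "\<And>y. 0 \<le> w y" "\<And>y. 0 \<le> \<sigma> y" "\<And>y. 0 \<le> g y"
    and p: "p > 0" and "N > 0" "0 \<le> c"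
    and f: "(\<integral>\<^sup>+y. ennreal (\<sigma> y * \<bar>f y\<bar> powr p) \<partial>lborel) \<le> ennreal N"
    and g: "ennreal (c powr p * N) \<le> (\<integral>\<^sup>+y. ennreal (w y * g y powr p) \<partial>lborel)"
    and S: "\<And>x. x \<in> space (lebd 1) \<Longrightarrow> ennreal (g (x 0)) \<le> square_fun 1 (\<lambda>x. f (x 0) * \<sigma> (x 0)) x"
  shows "ennreal c \<le> S_norm 1 p (\<lambda>x. w (x 0)) (\<lambda>x. \<sigma> (x 0))"
proof (rule S_norm_ge[where N = "N powr (1 / p)"])
  show "(\<lambda>x. f (x 0)) \<in> borel_measurable (weighted 1 (\<lambda>x. \<sigma> (x 0)))"
    unfolding weighted_def by measurable
  show "N powr (1 / p) > 0" using \<open>N > 0\<close> by simp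
  have "Lp_norm p (weighted 1 (\<lambda>x. \<sigma> (x 0))) (\<lambda>x. ennreal \<bar>f (x 0)\<bar>) =
      epowr (\<integral>\<^sup>+y. ennreal (\<sigma> y * \<bar>f y\<bar> powr p) \<partial>lborel) (1 / p)"
    using assms by (intro Lp_norm_weighted_lift[where g = "\<lambda>y. \<bar>f y\<bar>"]) auto
  also have "\<dots> \<le> epowr (ennreal N) (1 / p)" using f p by (intro epowr_mono) auto
  also have "\<dots> = ennreal (N powr (1 / p))" using \<open>N > 0\<close> by (simp add: epowr_ennreal)
  finally show "Lp_norm p (weighted 1 (\<lambda>x. \<sigma> (x 0))) (\<lambda>x. ennreal \<bar>f (x 0)\<bar>) \<le> ennreal (N powr (1 / p))" .
  have "ennreal (c * N powr (1 / p)) = epowr (ennreal (c powr p * N)) (1 / p)"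
    using \<open>N > 0\<close> \<open>0 \<le> c\<close> p by (simp add: epowr_ennreal powr_mult powr_powr)
  also have "\<dots> \<le> epowr (\<integral>\<^sup>+y. ennreal (w y * g y powr p) \<partial>lborel) (1 / p)"
    using g p by (intro epowr_mono) auto
  also have "\<dots> = Lp_norm p (weighted 1 (\<lambda>x. w (x 0))) (\<lambda>x. ennreal (g (x 0)))"
    using assms by (intro Lp_norm_weighted_lift[symmetric]) auto
  also have "\<dots> \<le> Lp_norm p (weighted 1 (\<lambda>x. w (x 0))) (square_fun 1 (\<lambda>x. f (x 0) * \<sigma> (x 0)))"
    using p S by (intro Lp_norm_mono) (auto simp: weighted_def)
  finally show "ennreal (c * N powr (1 / p)) \<le>
      Lp_norm p (weighted 1 (\<lambda>x. w (x 0))) (square_fun 1 (\<lambda>x. f (x 0) * \<sigma> (x 0)))" .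
qed

section \<open>The square function of a negative power\<close>

lemma ex_dyadic_annulus:
  fixes y :: real
  assumes "0 < y" "y < 1"
  obtains j where "(1/2) ^ Suc j \<le> y" "y < (1/2) ^ j"
proof -
  define n where "n = (LEAST n. (1/2) ^ n \<le> y)"
  have "\<exists>n. (1/2) ^ n \<le> y"
    using real_arch_pow_inv[OF assms(1), of "1/2"] by (auto intro: less_imp_le)
  hence le: "(1/2) ^ n \<le> y" unfolding n_def by (rule LeastI_ex)
  have "n \<noteq> 0" using le assms by (cases n) auto
  then obtain j where j: "n = Suc j" using not0_implies_Suc by blast
  have "\<not> (1/2) ^ j \<le> y" using not_less_Least[of j "\<lambda>n. (1/2) ^ n \<le> y"] j unfolding n_def by simp
  with le j that show ?thesis by force
qed

lemma avg_cong_AE: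
  assumes "u \<in> borel_measurable borel" "v \<in> borel_measurable borel"
    and "AE y in lborel. y \<in> {a..<b} \<longrightarrow> u y = v y"
  shows "avg u a b = avg v a b"
  unfolding avg_def using assms by (simp add: set_lebesgue_integral_cong_AE[of _ lborel u v])

text \<open>On the dyadic annulus next to the origin in \<open>[0,h)\<close> the power is about \<open>h\<^sup>t\<^sup>-\<^sup>1\<close>, whereas its
  average over \<open>[0,h)\<close> is \<open>h\<^sup>t\<^sup>-\<^sup>1 / t\<close>; a single martingale difference is therefore already large.\<close>

lemma square_fun_negative_power_ge:
  assumes t: "0 < t" "t \<le> 1 / 4" and x: "x \<in> space (lebd 1)"
  shows "ennreal (indicator {0..<1} (x 0) * (\<bar>x 0\<bar> powr (t - 1) / (4 * t))) \<le>
    square_fun 1 (\<lambda>x. indicator {0..<1} (x 0) * \<bar>x 0\<bar> powr (t - 1)) x"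
proof (cases "0 < x 0 \<and> x 0 < 1")
  \<comment> \<open>This covers the origin, where \<open>0 powr (t - 1)\<close> is
    \<open>0\<close>.\<close>
  case False
  thus ?thesis by (auto simp: indicator_def)
next
  case True
  define \<sigma> where "\<sigma> = (\<lambda>y::real. \<bar>y\<bar> powr (t - 1))"
  define u where "u = (\<lambda>y. indicator {0..<1} y * \<sigma> y)"
  have lpi: "locally_pos_integrable \<sigma>"
    unfolding \<sigma>_def using t by (intro power_locally_pos_integrable) simp
  have [measurable]: "\<sigma> \<in> borel_measurable borel" "u \<in> borel_measurable borel"
    unfolding \<sigma>_def u_def by measurable
  obtain j where j: "(1/2) ^ Suc j \<le> x 0" "x 0 < (1/2) ^ j"
    using ex_dyadic_annulus True by blast
  define h :: real where "h = (1/2) ^ j"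
  have h: "0 < h" "h \<le> 1" "(1/2) ^ Suc j = h / 2"
    by (auto simp: h_def power_le_one)
  have half: "(h / 2) powr (t - 1) \<le> 2 * h powr (t - 1)"
  proof -
    have "(h / 2) powr (t - 1) = 2 powr (1 - t) * h powr (t - 1)"
      using h by (simp add: powr_divide powr_diff)
    also have "2 powr (1 - t) \<le> 2 powr (1::real)" using t by (intro powr_mono) auto
    finally show ?thesis by (simp add: mult_right_mono)
  qed
  have "avg u (h / 2) h = avg \<sigma> (h / 2) h"
    using h by (intro avg_cong_AE) (auto simp: u_def)
  also have "\<dots> \<le> (h / 2) powr (t - 1)"
    using t h by (intro avg_le[OF lpi]) (auto simp: \<sigma>_def intro!: powr_mono2')
  finally have R: "avg u (h / 2) h \<le> 2 * h powr (t - 1)" using half by simp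
  have "avg u 0 h = avg \<sigma> 0 h"
    using h by (intro avg_cong_AE) (auto simp: u_def)
  also have "\<dots> = h powr t / t / h"
    using set_integral_power_0[of "t - 1" h] t h by (simp add: avg_def \<sigma>_def)
  finally have Q: "avg u 0 h = h powr (t - 1) / t" using h by (simp add: powr_diff)
  \<comment> \<open>This is where \<open>t \<le> 1 / 4\<close> enters: the average over the annulus
    is at most half of the average over \<open>[0,h)\<close>, so half of the latter survives in the
    difference.\<close>
  have "2 * h powr (t - 1) \<le> h powr (t - 1) / (2 * t)"
    using t h by (simp add: field_simps)
  moreover have "h powr (t - 1) / t = h powr (t - 1) / (2 * t) + h powr (t - 1) / (2 * t)"
    using t by (simp add: field_simps)
  ultimately have "h powr (t - 1) / (2 * t) \<le> avg u 0 h - avg u (h / 2) h"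
    using R Q by linarith
  \<comment> \<open>Replacing \<open>h\<close> by \<open>\<bar>x 0\<bar>\<close>, which is at least
    \<open>h / 2\<close>, costs a factor 2 and turns \<open>2 * t\<close> into
    \<open>4 * t\<close>.\<close>
  moreover have "\<bar>x 0\<bar> powr (t - 1) \<le> (h / 2) powr (t - 1)"
    using j h t by (intro powr_mono2') auto
  hence "\<bar>x 0\<bar> powr (t - 1) / (4 * t) \<le> 2 * h powr (t - 1) / (4 * t)"
    using half t by (intro divide_right_mono) auto
  ultimately have le: "\<bar>x 0\<bar> powr (t - 1) / (4 * t) \<le> avg u 0 h - avg u (h / 2) h" by simp
  have md: "mart_diff 1 (seg 0 h) (\<lambda>x. u (x 0)) x = avg u (h / 2) h - avg u 0 h"
    using mart_diff_initial(2)[of u x j] x j h unfolding h_def[symmetric] h(3) by simp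
  have "ennreal (\<bar>x 0\<bar> powr (t - 1) / (4 * t)) \<le> square_fun 1 (\<lambda>x. u (x 0)) x"
  proof (rule square_fun_ge[of "{seg 0 h}"])
    show "{seg 0 h} \<subseteq> dyadic 1" unfolding h_def using dyadic_initial by simp
    show "(\<bar>x 0\<bar> powr (t - 1) / (4 * t))\<^sup>2 \<le> (\<Sum>Q\<in>{seg 0 h}. (mart_diff 1 Q (\<lambda>x. u (x 0)) x)\<^sup>2)"
      using power_mono[OF le, of 2] t by (simp add: md power2_commute)
  qed (use t in auto)
  thus ?thesis using True by (simp add: u_def \<sigma>_def)
qed

section \<open>The alternating step functions\<close>

text \<open>In closed form the value is \<open>(-1) ^ j\<close> on
  \<open>[(1/2) ^ Suc j, (1/2) ^ j)\<close> for \<open>j < n\<close> and \<open>(-1) ^ n / 3\<close>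
  on \<open>[0, (1/2) ^ n)\<close>, where 1/3 is the mean over \<open>[0,1)\<close> of the infinite
  alternating pattern. Each step adds a function of mean zero.\<close>

primrec alternating_step :: "nat \<Rightarrow> real \<Rightarrow> real" where
  "alternating_step 0 y = 1 / 3 * indicator {0..<1} y"
| "alternating_step (Suc n) y = alternating_step n y + 2 / 3 * (-1) ^ n *
     (indicator {(1/2) ^ Suc n..<(1/2) ^ n} y - indicator {0..<(1/2) ^ Suc n} y)"

lemma alternating_step_measurable [measurable]: "alternating_step n \<in> borel_measurable borel"
proof (induction n)
  case 0
  have "alternating_step 0 = (\<lambda>y. 1 / 3 * indicator {0..<1} y)" by (rule ext) simp
  thus ?case by simp
next
  case (Suc n)
  note [measurable] = Suc.IH
  have "alternating_step (Suc n) = (\<lambda>y. alternating_step n y + 2 / 3 * (-1) ^ n *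
     (indicator {(1/2) ^ Suc n..<(1/2) ^ n} y - indicator {0..<(1/2) ^ Suc n} y))" by (rule ext) simp
  thus ?case by simp
qed

lemma half_power_less: "(1/2::real) ^ Suc n < (1/2) ^ n"
  by simp

lemma half_power_antimono: "i \<le> j \<Longrightarrow> (1/2::real) ^ j \<le> (1/2) ^ i"
  by (intro power_decreasing) auto

lemma alternating_step_core:
  assumes "0 \<le> y" "y < (1/2) ^ n"
  shows "alternating_step n y = (-1) ^ n / 3"
  using assms
proof (induction n)
  case (Suc n)
  hence "y < (1/2) ^ n" using half_power_less[of n] by linarith
  with Suc show ?case by (simp add: indicator_def field_simps)
qed simp

text \<open>A step changes only the core \<open>[0, (1/2) ^ n)\<close>: its upper half receives the
  modulus 1/3 + 2/3 = 1, and its lower half keeps the modulus 1/3.\<close>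

lemma alternating_step_abs_le: "\<bar>alternating_step n y\<bar> \<le> indicator {0..<1} y"
proof (induction n)
  case 0
  thus ?case by (simp add: indicator_def)
next
  case (Suc n)
  have le1: "(1/2::real) ^ n \<le> 1" by (simp add: power_le_one)
  consider "0 \<le> y \<and> y < (1/2) ^ n" | "y < 0 \<or> (1/2) ^ n \<le> y" by linarith
  thus ?case
  proof cases
    case 1
    hence "alternating_step n y = (-1) ^ n / 3" by (simp add: alternating_step_core)
    thus ?thesis using 1 le1 by (cases "even n") (auto simp: indicator_def)
  next
    case 2
    have "0 < (1/2::real) ^ Suc n" by simp
    hence "indicator {(1/2) ^ Suc n..<(1/2) ^ n} y = (0::real)" "indicator {0..<(1/2) ^ Suc n} y = (0::real)"
      using 2 half_power_less[of n] unfolding indicator_eq_0_iff atLeastLessThan_iff by linarith+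
    thus ?thesis using Suc by simp
  qed
qed

lemma set_integrable_alternating_step: "set_integrable lborel {a..<b} (alternating_step n)"
proof (rule set_integrable_bound[where f = "\<lambda>_. 1 :: real"])
  show "set_integrable lborel {a..<b} (\<lambda>_. 1 :: real)"
    by (cases "a \<le> b") (simp_all add: set_integrable_def)
  show "AE y in lborel. y \<in> {a..<b} \<longrightarrow> norm (alternating_step n y) \<le> norm (1::real)"
    using order_trans[OF alternating_step_abs_le indicator_le_1] by simp
qed (simp add: set_borel_measurable_def)

lemma set_integral_indicator_subset:
  fixes a b c d :: real
  assumes "c \<le> a" "a \<le> b" "b \<le> d"
  shows "(LBINT y:{c..<d}. indicator {a..<b} y) = b - a"
proof -
  have "(LBINT y:{c..<d}. indicator {a..<b} y :: real) = (LBINT y. indicator {a..<b} y)"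
    unfolding set_lebesgue_integral_def using assms
    by (intro Bochner_Integration.integral_cong) (auto simp: indicator_def)
  thus ?thesis using assms by simp
qed

text \<open>The correction from \<open>n\<close> to \<open>Suc n\<close> has opposite masses on two
  sets of equal length, both inside \<open>[0, (1/2) ^ j)\<close> for \<open>j \<le> n\<close>. The
  integral is therefore fixed from stage \<open>j\<close> on, where the function is constant on the
  interval.\<close>

lemma set_integral_alternating_step:
  "j \<le> n \<Longrightarrow> (LBINT y:{0..<(1/2) ^ j}. alternating_step n y) = (-1) ^ j / 3 * (1/2) ^ j"
proof (induction n arbitrary: j)
  case 0
  thus ?case by (simp add: set_integral_indicator_subset)
next
  case (Suc n)
  show ?case
  proof (cases "j = Suc n")
    case True
    have "(LBINT y:{0..<(1/2) ^ j}. alternating_step (Suc n) y) =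
        (LBINT y:{0..<(1/2::real) ^ j}. (-1) ^ j / 3)"
      using True by (intro set_lebesgue_integral_cong) (auto simp: alternating_step_core simp del: alternating_step.simps)
    also have "\<dots> = (-1) ^ j / 3 * (1/2) ^ j" by (simp add: set_lebesgue_integral_def)
    finally show ?thesis .
  next
    case False
    hence j: "j \<le> n" using Suc.prems by simp
    let ?A = "{(1/2::real) ^ Suc n..<(1/2) ^ n}" and ?B = "{0..<(1/2::real) ^ Suc n}"
      and ?I = "{0..<(1/2::real) ^ j}"
    have le: "(1/2::real) ^ Suc n \<le> (1/2) ^ n" "(1/2::real) ^ n \<le> (1/2) ^ j" "0 \<le> (1/2::real) ^ Suc n"
      using half_power_antimono j by auto
    have ind: "set_integrable lborel ?I (\<lambda>y. indicator {a..<b} y :: real)" for a b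
    proof (rule set_integrable_bound[where f = "\<lambda>_. 1 :: real"])
      show "set_integrable lborel ?I (\<lambda>_. 1 :: real)" by (simp add: set_integrable_def)
    qed (auto simp: set_borel_measurable_def)
    have "(LBINT y:?I. alternating_step (Suc n) y) = (LBINT y:?I. alternating_step n y) +
        2 / 3 * (-1) ^ n * ((LBINT y:?I. indicat_real ?A y) - (LBINT y:?I. indicat_real ?B y))"
      using set_integrable_alternating_step ind
      by (simp add: set_integral_add set_integral_diff del: power_Suc)
    moreover have "(LBINT y:?I. indicat_real ?A y) = (LBINT y:?I. indicat_real ?B y)"
      using set_integral_indicator_subset[of 0 "(1/2) ^ Suc n" "(1/2) ^ n" "(1/2) ^ j"]
        set_integral_indicator_subset[of 0 0 "(1/2) ^ Suc n" "(1/2) ^ j"] le by simp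
    ultimately show ?thesis using Suc.IH[OF j] by simp
  qed
qed

lemma avg_alternating_step: "j \<le> n \<Longrightarrow> avg (alternating_step n) 0 ((1/2) ^ j) = (-1) ^ j / 3"
  by (simp add: avg_def set_integral_alternating_step)

text \<open>Consecutive averages have modulus 1/3 and opposite signs, so each of the
  \<open>n\<close> initial intervals contributes 4/9. Equality almost everywhere is assumed because
  the intended \<open>u\<close> may deviate at the origin.\<close>

lemma square_fun_alternating_step_ge:
  assumes [measurable]: "u \<in> borel_measurable borel" and AE: "AE y in lborel. u y = alternating_step n y"
    and x: "x \<in> space (lebd 1)"
  shows "ennreal (indicator {0..<(1/2) ^ n} (x 0) * (2 / 3 * sqrt n)) \<le> square_fun 1 (\<lambda>x. u (x 0)) x"
proof (cases "0 \<le> x 0 \<and> x 0 < (1/2) ^ n")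
  case False
  thus ?thesis by (auto simp: indicator_def)
next
  case True
  define Q where "Q j = seg 0 ((1/2) ^ j)" for j :: nat
  \<comment> \<open>The \<open>n\<close> intervals must be distinct for their contributions to add
    up to \<open>4 / 9 * n\<close>.\<close>
  have inj: "inj_on Q {..<n}"
  proof (rule inj_onI)
    fix i j assume "Q i = Q j"
    hence "(1/2::real) ^ i = (1/2) ^ j"
      unfolding Q_def using seg_subset_iff[of 0 "(1/2) ^ i" 0 "(1/2) ^ j"]
        seg_subset_iff[of 0 "(1/2) ^ j" 0 "(1/2) ^ i"] by simp
    thus "i = j"
      using power_strict_decreasing[of i j "1/2::real"] power_strict_decreasing[of j i "1/2::real"]
      by (cases i j rule: linorder_cases) auto
  qed
  have avg: "avg u 0 ((1/2) ^ j) = (-1) ^ j / 3" if "j \<le> n" for j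
    using avg_alternating_step[OF that] AE
    by (subst avg_cong_AE[of u "alternating_step n"]) auto
  have md: "(mart_diff 1 (Q j) (\<lambda>x. u (x 0)) x)\<^sup>2 = 4 / 9" if "j < n" for j
  proof -
    have "(1/2::real) ^ n \<le> (1/2) ^ Suc j" using that by (intro half_power_antimono) simp
    hence "x 0 \<in> {0..<(1/2) ^ Suc j}" using True by auto
    hence "mart_diff 1 (Q j) (\<lambda>x. u (x 0)) x = (-1) ^ Suc j / 3 - (-1) ^ j / 3"
      unfolding Q_def using that by (subst mart_diff_initial(1)[OF _ x]) (auto simp: avg simp del: power_Suc)
    also have "\<dots> = - ((-1) ^ j * (2 / 3))" by simp
    finally show ?thesis by (simp add: power_mult_distrib power2_eq_square flip: power_add)
  qed
  have "ennreal (2 / 3 * sqrt n) \<le> square_fun 1 (\<lambda>x. u (x 0)) x"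
  proof (rule square_fun_ge[of "Q ` {..<n}"])
    show "Q ` {..<n} \<subseteq> dyadic 1" unfolding Q_def using dyadic_initial by auto
    show "(2 / 3 * sqrt n)\<^sup>2 \<le> (\<Sum>Q\<in>Q ` {..<n}. (mart_diff 1 Q (\<lambda>x. u (x 0)) x)\<^sup>2)"
      by (simp add: sum.reindex[OF inj] md power_mult_distrib power_divide)
  qed auto
  thus ?thesis using True by simp
qed

section \<open>Extremal pairs of weights\<close>

text \<open>Both averages are compared with the powers at the larger endpoint modulus
  \<open>m\<close>. The exponents are dual, so the powers of \<open>m\<close> cancel.\<close>

lemma A_p_power_le:
  assumes "0 < t" "t \<le> 1" "0 \<le> s" "1 < p" "s = (p - 1) * (1 - t)"
  shows "A_p 1 p (\<lambda>x. \<bar>x 0\<bar> powr s) (\<lambda>x. \<bar>x 0\<bar> powr (t - 1)) \<le> ennreal ((4 / t) powr (p - 1))"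
proof (rule A_p_le)
  fix a b :: real assume "a < b"
  define m where "m = max \<bar>a\<bar> \<bar>b\<bar>"
  have m: "m > 0" using \<open>a < b\<close> by (auto simp: m_def)
  have "avg (\<lambda>y. \<bar>y\<bar> powr (t - 1)) a b > 0"
    using assms \<open>a < b\<close> by (intro avg_pos power_locally_pos_integrable) auto
  moreover have "avg (\<lambda>y. \<bar>y\<bar> powr (t - 1)) a b \<le> 4 / t * m powr (t - 1)"
    unfolding m_def using assms \<open>a < b\<close> by (intro avg_negative_power_le) auto
  ultimately have "avg (\<lambda>y. \<bar>y\<bar> powr (t - 1)) a b powr (p - 1) \<le> (4 / t * m powr (t - 1)) powr (p - 1)"
    using assms by (intro powr_mono2) auto
  moreover have "avg (\<lambda>y. \<bar>y\<bar> powr s) a b \<le> m powr s"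
    unfolding m_def using assms \<open>a < b\<close> by (intro avg_nonneg_power_le) auto
  ultimately have "avg (\<lambda>y. \<bar>y\<bar> powr s) a b * avg (\<lambda>y. \<bar>y\<bar> powr (t - 1)) a b powr (p - 1)
      \<le> m powr s * (4 / t * m powr (t - 1)) powr (p - 1)"
    by (intro mult_mono) auto
  also have "\<dots> = (4 / t) powr (p - 1) * m powr (s + (t - 1) * (p - 1))"
    using assms by (subst powr_mult) (auto simp: powr_powr powr_add)
  also have "s + (t - 1) * (p - 1) = 0" using assms by (simp add: algebra_simps)
  finally show "avg (\<lambda>y. \<bar>y\<bar> powr s) a b * avg (\<lambda>y. \<bar>y\<bar> powr (t - 1)) a b powr (p - 1) \<le> (4 / t) powr (p - 1)"
    using m by simp
qed auto

text \<open>The same cancellation with the weights exchanged: the factor \<open>4 / t\<close> now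
  comes from the first weight and is not raised to the power \<open>p - 1\<close>.\<close>

lemma A_p_power_dual_le:
  assumes "0 < t" "t \<le> 1" "0 \<le> s" "1 < p" "s * (p - 1) = 1 - t"
  shows "A_p 1 p (\<lambda>x. \<bar>x 0\<bar> powr (t - 1)) (\<lambda>x. \<bar>x 0\<bar> powr s) \<le> ennreal (4 / t)"
proof (rule A_p_le)
  fix a b :: real assume "a < b"
  define m where "m = max \<bar>a\<bar> \<bar>b\<bar>"
  have m: "m > 0" using \<open>a < b\<close> by (auto simp: m_def)
  have "avg (\<lambda>y. \<bar>y\<bar> powr s) a b > 0"
    using assms \<open>a < b\<close> by (intro avg_pos power_locally_pos_integrable) auto
  moreover have "avg (\<lambda>y. \<bar>y\<bar> powr s) a b \<le> m powr s"
    unfolding m_def using assms \<open>a < b\<close> by (intro avg_nonneg_power_le) auto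
  ultimately have "avg (\<lambda>y. \<bar>y\<bar> powr s) a b powr (p - 1) \<le> (m powr s) powr (p - 1)"
    using assms by (intro powr_mono2) auto
  moreover have "avg (\<lambda>y. \<bar>y\<bar> powr (t - 1)) a b \<le> 4 / t * m powr (t - 1)"
    unfolding m_def using assms \<open>a < b\<close> by (intro avg_negative_power_le) auto
  ultimately have "avg (\<lambda>y. \<bar>y\<bar> powr (t - 1)) a b * avg (\<lambda>y. \<bar>y\<bar> powr s) a b powr (p - 1)
      \<le> 4 / t * m powr (t - 1) * (m powr s) powr (p - 1)"
    using assms by (intro mult_mono) auto
  also have "\<dots> = 4 / t * m powr (t - 1 + s * (p - 1))"
    unfolding powr_add powr_powr by (simp only: mult_ac)
  also have "t - 1 + s * (p - 1) = 0" using assms by simp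
  finally show "avg (\<lambda>y. \<bar>y\<bar> powr (t - 1)) a b * avg (\<lambda>y. \<bar>y\<bar> powr s) a b powr (p - 1) \<le> 4 / t"
    using m by simp
qed auto

text \<open>Writing \<open>w\<close> and \<open>\<sigma>\<close> for the two weights,
  \<open>w * \<sigma> powr p = \<sigma>\<close>. Hence the minorant
  \<open>\<sigma> / (4 * t)\<close> has norm \<open>1 / (4 * t)\<close> times that of the indicator,
  both coming from the mass \<open>1 / t\<close> of \<open>\<sigma>\<close> on
  \<open>[0,1)\<close>.\<close>

lemma S_norm_power_ge:
  assumes t: "0 < t" "t \<le> 1 / 4" and p: "1 < p"
  shows "ennreal (1 / (4 * t)) \<le>
    S_norm 1 p (\<lambda>x. \<bar>x 0\<bar> powr ((p - 1) * (1 - t))) (\<lambda>x. \<bar>x 0\<bar> powr (t - 1))"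
proof (rule S_norm_lift_ge[where f = "indicator {0..<1}" and N = "1 / t" and
      g = "\<lambda>y. indicator {0..<1} y * (\<bar>y\<bar> powr (t - 1) / (4 * t))" and
      \<sigma> = "\<lambda>y. \<bar>y\<bar> powr (t - 1)" and w = "\<lambda>y. \<bar>y\<bar> powr ((p - 1) * (1 - t))"])
  have int: "(\<integral>\<^sup>+y\<in>{0..<1}. ennreal (\<bar>y\<bar> powr (t - 1)) \<partial>lborel) = ennreal (1 / t)"
    using nn_integral_power_0[of "t - 1" 1] t by simp
  have "(\<integral>\<^sup>+y. ennreal (\<bar>y\<bar> powr (t - 1) * \<bar>indicator {0..<1} y\<bar> powr p) \<partial>lborel) =
      (\<integral>\<^sup>+y\<in>{0..<1}. ennreal (\<bar>y\<bar> powr (t - 1)) \<partial>lborel)"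
    using p by (intro nn_integral_cong) (auto simp: indicator_def)
  thus "(\<integral>\<^sup>+y. ennreal (\<bar>y\<bar> powr (t - 1) * \<bar>indicator {0..<1} y\<bar> powr p) \<partial>lborel) \<le> ennreal (1 / t)"
    using int by simp
  have pt: "\<bar>y\<bar> powr ((p - 1) * (1 - t)) * (\<bar>y\<bar> powr (t - 1) / (4 * t)) powr p =
      (1 / (4 * t)) powr p * \<bar>y\<bar> powr (t - 1)" for y :: real
  proof (cases "y = 0")
    case False
    have "\<bar>y\<bar> powr ((p - 1) * (1 - t)) * (\<bar>y\<bar> powr (t - 1) / (4 * t)) powr p =
        (1 / (4 * t)) powr p * \<bar>y\<bar> powr ((p - 1) * (1 - t) + (t - 1) * p)"
      using t by (simp add: powr_divide powr_powr powr_add)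
    also have "(p - 1) * (1 - t) + (t - 1) * p = t - 1" by (simp add: algebra_simps)
    finally show ?thesis .
  qed (use p in simp)
  have "(\<integral>\<^sup>+y. ennreal (\<bar>y\<bar> powr ((p - 1) * (1 - t)) *
        (indicator {0..<1} y * (\<bar>y\<bar> powr (t - 1) / (4 * t))) powr p) \<partial>lborel) =
      (\<integral>\<^sup>+y. ennreal ((1 / (4 * t)) powr p) * (ennreal (\<bar>y\<bar> powr (t - 1)) * indicator {0..<1} y) \<partial>lborel)"
  proof (intro nn_integral_cong)
    show "ennreal (\<bar>y\<bar> powr ((p - 1) * (1 - t)) *
        (indicator {0..<1} y * (\<bar>y\<bar> powr (t - 1) / (4 * t))) powr p) =
      ennreal ((1 / (4 * t)) powr p) * (ennreal (\<bar>y\<bar> powr (t - 1)) * indicator {0..<1} y)" for y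
      using pt[of y] p by (auto simp: indicator_def ennreal_mult[symmetric])
  qed
  also have "\<dots> = ennreal ((1 / (4 * t)) powr p) * ennreal (1 / t)"
    by (subst nn_integral_cmult) (auto simp: int)
  finally show "ennreal ((1 / (4 * t)) powr p * (1 / t)) \<le> (\<integral>\<^sup>+y. ennreal (\<bar>y\<bar> powr ((p - 1) * (1 - t)) *
        (indicator {0..<1} y * (\<bar>y\<bar> powr (t - 1) / (4 * t))) powr p) \<partial>lborel)"
    using t by (simp add: ennreal_mult[symmetric])
  show "ennreal (indicator {0..<1} (x 0) * (\<bar>x 0\<bar> powr (t - 1) / (4 * t))) \<le>
      square_fun 1 (\<lambda>x. indicator {0..<1} (x 0) * \<bar>x 0\<bar> powr (t - 1)) x"
    if "x \<in> space (lebd 1)" for x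
    using square_fun_negative_power_ge[OF t that] .
qed (use t p in auto)

text \<open>The test function has alternating sign on the dyadic annuli, so that all its first \<open>n\<close>
  martingale differences have the same size on \<open>[0,2\<^sup>-\<^sup>n)\<close>, an interval that carries a
  fixed proportion of the mass of \<open>\<bar>y\<bar>\<^sup>t\<^sup>-\<^sup>1\<close> on \<open>[0,1)\<close> when \<open>n t \<le> 1\<close>.\<close>

lemma S_norm_power_dual_ge:
  assumes t: "0 < t" "t \<le> 1" and n: "real n * t \<le> 1" and p: "1 < p" and s: "0 \<le> s" "s * (p - 1) = 1 - t"
  shows "ennreal (sqrt n / 3) \<le> S_norm 1 p (\<lambda>x. \<bar>x 0\<bar> powr (t - 1)) (\<lambda>x. \<bar>x 0\<bar> powr s)"
\<comment> \<open>The factor \<open>\<bar>y\<bar> powr (-s)\<close> cancels \<open>\<sigma>\<close>,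
  so \<open>f * \<sigma>\<close> is the alternating step function off the origin. Since
  \<open>s - s * p = t - 1\<close>, the test function has \<open>p\<close>-th power norm at most
  \<open>1 / t\<close>.\<close>
proof (rule S_norm_lift_ge[where f = "\<lambda>y. alternating_step n y * \<bar>y\<bar> powr (-s)" and N = "1 / t" and
      g = "\<lambda>y. indicator {0..<(1/2) ^ n} y * (2 / 3 * sqrt n)" and
      w = "\<lambda>y. \<bar>y\<bar> powr (t - 1)" and \<sigma> = "\<lambda>y. \<bar>y\<bar> powr s"])
  have int: "(\<integral>\<^sup>+y\<in>{0..<c}. ennreal (\<bar>y\<bar> powr (t - 1)) \<partial>lborel) = ennreal (c powr t / t)" if "c \<ge> 0" for c
    using nn_integral_power_0[of "t - 1" c] t that by simp
  have "\<bar>y\<bar> powr s * \<bar>alternating_step n y * \<bar>y\<bar> powr (-s)\<bar> powr p \<le>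
      \<bar>y\<bar> powr (t - 1) * indicator {0..<1} y" for y
  proof -
    have "\<bar>alternating_step n y * \<bar>y\<bar> powr (-s)\<bar> \<le> indicator {0..<1} y * \<bar>y\<bar> powr (-s)"
      using alternating_step_abs_le[of n y] by (simp add: abs_mult mult_right_mono)
    hence "\<bar>alternating_step n y * \<bar>y\<bar> powr (-s)\<bar> powr p \<le> (indicator {0..<1} y * \<bar>y\<bar> powr (-s)) powr p"
      using p by (intro powr_mono2) auto
    also have "\<dots> = indicator {0..<1} y * \<bar>y\<bar> powr (-s * p)"
      using p by (auto simp: indicator_def powr_powr)
    finally have "\<bar>y\<bar> powr s * \<bar>alternating_step n y * \<bar>y\<bar> powr (-s)\<bar> powr p \<le>
        \<bar>y\<bar> powr s * (indicator {0..<1} y * \<bar>y\<bar> powr (-s * p))"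
      by (intro mult_left_mono) auto
    also have "\<dots> = \<bar>y\<bar> powr (s + (-s * p)) * indicator {0..<1} y"
      unfolding powr_add by (simp only: mult_ac)
    also have "s + (-s * p) = t - 1" using s by (simp add: algebra_simps)
    finally show ?thesis .
  qed
  hence "(\<integral>\<^sup>+y. ennreal (\<bar>y\<bar> powr s * \<bar>alternating_step n y * \<bar>y\<bar> powr (-s)\<bar> powr p) \<partial>lborel) \<le>
      (\<integral>\<^sup>+y. ennreal (\<bar>y\<bar> powr (t - 1) * indicator {0..<1} y) \<partial>lborel)"
    by (intro nn_integral_mono ennreal_leI)
  also have "\<dots> = (\<integral>\<^sup>+y\<in>{0..<1}. ennreal (\<bar>y\<bar> powr (t - 1)) \<partial>lborel)"
    by (intro nn_integral_cong) (auto simp: indicator_def)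
  finally show "(\<integral>\<^sup>+y. ennreal (\<bar>y\<bar> powr s * \<bar>alternating_step n y * \<bar>y\<bar> powr (-s)\<bar> powr p) \<partial>lborel) \<le>
      ennreal (1 / t)" using int[of 1] by simp
  have "(1/2) powr 1 \<le> (1/2::real) powr (real n * t)"
    using n by (intro powr_mono') auto
  hence half: "1 / 2 \<le> ((1/2::real) ^ n) powr t"
    by (simp add: powr_powr flip: powr_realpow)
  \<comment> \<open>The proportion 1/2 of the mass dominates \<open>(1/2) powr p\<close>, so it can
    be paid for by halving \<open>2 / 3 * sqrt n\<close>.\<close>
  have "(1/2::real) powr p \<le> (1/2) powr 1"
    using p by (intro powr_mono') auto
  have "(sqrt n / 3) powr p = (2 / 3 * sqrt n * (1/2)) powr p" by simp
  also have "\<dots> = (2 / 3 * sqrt n) powr p * (1/2) powr p" by (subst powr_mult) auto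
  also have "\<dots> \<le> (2 / 3 * sqrt n) powr p * ((1/2::real) ^ n) powr t"
    using half \<open>(1/2::real) powr p \<le> (1/2) powr 1\<close> by (intro mult_left_mono) auto
  finally have le: "(sqrt n / 3) powr p * (1 / t) \<le> (2 / 3 * sqrt n) powr p * (((1/2::real) ^ n) powr t / t)"
    using t by (simp add: divide_right_mono)
  have "ennreal ((sqrt n / 3) powr p * (1 / t)) \<le>
      ennreal ((2 / 3 * sqrt n) powr p) * ennreal (((1/2) ^ n) powr t / t)"
    using le t by (simp add: ennreal_mult[symmetric] ennreal_leI)
  also have "\<dots> = (\<integral>\<^sup>+y. ennreal ((2 / 3 * sqrt n) powr p) *
      (ennreal (\<bar>y\<bar> powr (t - 1)) * indicator {0..<(1/2) ^ n} y) \<partial>lborel)"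
    by (subst nn_integral_cmult) (auto simp: int)
  also have "\<dots> = (\<integral>\<^sup>+y. ennreal (\<bar>y\<bar> powr (t - 1) * (indicator {0..<(1/2) ^ n} y * (2 / 3 * sqrt n)) powr p) \<partial>lborel)"
    using p by (intro nn_integral_cong) (auto simp: indicator_def ennreal_mult[symmetric] mult.commute)
  finally show "ennreal ((sqrt n / 3) powr p * (1 / t)) \<le>
     (\<integral>\<^sup>+y. ennreal (\<bar>y\<bar> powr (t - 1) * (indicator {0..<(1/2) ^ n} y * (2 / 3 * sqrt n)) powr p) \<partial>lborel)" .
  have "AE y in lborel. alternating_step n y * \<bar>y\<bar> powr (-s) * \<bar>y\<bar> powr s = alternating_step n y"
    using AE_lborel_singleton[of 0] by eventually_elim (simp add: mult.assoc flip: powr_add)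
  thus "ennreal (indicator {0..<(1/2) ^ n} (x 0) * (2 / 3 * sqrt n)) \<le>
      square_fun 1 (\<lambda>x. alternating_step n (x 0) * \<bar>x 0\<bar> powr (-s) * \<bar>x 0\<bar> powr s) x"
    if "x \<in> space (lebd 1)" for x
    using that by (intro square_fun_alternating_step_ge) auto
qed (use t p in auto)

section \<open>Pairs of weights with one \<open>A_infty\<close> constant at most
  \<open>x\<close>\<close>

text \<open>With \<open>t = 4 / x\<close> the bound \<open>4 / t\<close> becomes \<open>x\<close>,
  and \<open>16 < x\<close> ensures \<open>t \<le> 1 / 4\<close>. The bound for \<open>w\<close>
  does not depend on \<open>x\<close> because its exponent is at most \<open>p - 1\<close>.\<close>

lemma ex_weights_large_sigma:
  fixes p x :: real
  assumes p: "1 < p" and x: "16 < x"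
  obtains w \<sigma> where "is_weight 1 w" "is_weight 1 \<sigma>"
    "1 \<le> A_infty 1 \<sigma>" "A_infty 1 \<sigma> \<le> ennreal x" "1 \<le> A_infty 1 w" "A_infty 1 w \<le> ennreal (4 * 2 powr (p - 1))"
    "A_p 1 p w \<sigma> \<le> ennreal (x powr (p - 1))" "ennreal (x / 16) \<le> S_norm 1 p w \<sigma>"
proof -
  define t where "t = 4 / x"
  have t: "0 < t" "t \<le> 1 / 4" "4 / t = x" "1 / (4 * t) = x / 16"
    using x by (auto simp: t_def field_simps)
  define s where "s = (p - 1) * (1 - t)"
  have s: "0 \<le> s" "s \<le> p - 1" using p t by (auto simp: s_def intro!: mult_left_le)
  have lpi: "locally_pos_integrable (\<lambda>y. \<bar>y\<bar> powr s)" "locally_pos_integrable (\<lambda>y. \<bar>y\<bar> powr (t - 1))"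
    using s t by (auto intro!: power_locally_pos_integrable)
  show ?thesis
  proof (rule that[OF is_weight_lift is_weight_lift A_infty_ge_1 _ A_infty_ge_1])
    show "A_infty 1 (\<lambda>x. \<bar>x 0\<bar> powr (t - 1)) \<le> ennreal x"
      using A_infty_negative_power_le[of t] t by simp
    have "A_infty 1 (\<lambda>x. \<bar>x 0\<bar> powr s) \<le> ennreal (4 * 2 powr s)"
      by (rule A_infty_nonneg_power_le[OF s(1)])
    also have "\<dots> \<le> ennreal (4 * 2 powr (p - 1))" using s by (intro ennreal_leI) auto
    finally show "A_infty 1 (\<lambda>x. \<bar>x 0\<bar> powr s) \<le> ennreal (4 * 2 powr (p - 1))" .
    show "A_p 1 p (\<lambda>x. \<bar>x 0\<bar> powr s) (\<lambda>x. \<bar>x 0\<bar> powr (t - 1)) \<le> ennreal (x powr (p - 1))"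
      using A_p_power_le[of t s p] t s p by (simp add: s_def)
    show "ennreal (x / 16) \<le> S_norm 1 p (\<lambda>x. \<bar>x 0\<bar> powr s) (\<lambda>x. \<bar>x 0\<bar> powr (t - 1))"
      using S_norm_power_ge[OF t(1,2) p] unfolding t(4) s_def .
  qed (rule lpi)+
qed

text \<open>The dual pair with \<open>t = 4 / x\<close>. As \<open>p > 2\<close>, the exponent of
  \<open>\<sigma>\<close> is at most 1, which gives the uniform bound 8.\<close>

lemma ex_weights_large_w:
  fixes p x :: real
  assumes p: "2 < p" and x: "16 < x"
  obtains w \<sigma> where "is_weight 1 w" "is_weight 1 \<sigma>"
    "1 \<le> A_infty 1 w" "A_infty 1 w \<le> ennreal x" "1 \<le> A_infty 1 \<sigma>" "A_infty 1 \<sigma> \<le> ennreal 8"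
    "A_p 1 p w \<sigma> \<le> ennreal x" "ennreal (sqrt x / 9) \<le> S_norm 1 p w \<sigma>"
proof -
  define t where "t = 4 / x"
  have t: "0 < t" "t \<le> 1" "4 / t = x"
    using x by (auto simp: t_def field_simps)
  define s where "s = (1 - t) / (p - 1)"
  have s: "0 \<le> s" "s \<le> 1" "s * (p - 1) = 1 - t" using p t by (auto simp: s_def field_simps)
  \<comment> \<open>The largest \<open>n\<close> with \<open>n * t \<le> 1\<close>, since
    \<open>1 / t = x / 4\<close>.\<close>
  define n where "n = nat \<lfloor>x / 4\<rfloor>"
  have "real n \<le> x / 4" and n: "x / 8 \<le> real n" using x unfolding n_def by linarith+
  hence nt: "real n * t \<le> 1" using x by (simp add: t_def field_simps)
  \<comment> \<open>The bound \<open>x / 8 \<le> n\<close> is weakened to \<open>x / 9\<close> for a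
    rational root.\<close>
  have "sqrt x / 3 = sqrt (x / 9)" by (simp add: real_sqrt_divide)
  also have "\<dots> \<le> sqrt n" using n x by (intro real_sqrt_le_mono) linarith
  finally have sqrt: "sqrt x / 9 \<le> sqrt n / 3" by simp
  have lpi: "locally_pos_integrable (\<lambda>y. \<bar>y\<bar> powr s)" "locally_pos_integrable (\<lambda>y. \<bar>y\<bar> powr (t - 1))"
    using s t by (auto intro!: power_locally_pos_integrable)
  show ?thesis
  proof (rule that[OF is_weight_lift is_weight_lift A_infty_ge_1 _ A_infty_ge_1])
    show "A_infty 1 (\<lambda>x. \<bar>x 0\<bar> powr (t - 1)) \<le> ennreal x"
      using A_infty_negative_power_le[of t] t by simp
    have "A_infty 1 (\<lambda>x. \<bar>x 0\<bar> powr s) \<le> ennreal (4 * 2 powr s)"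
      by (rule A_infty_nonneg_power_le[OF s(1)])
    also have "\<dots> \<le> ennreal 8"
      using powr_mono[of s 1 "2::real"] s by (intro ennreal_leI) auto
    finally show "A_infty 1 (\<lambda>x. \<bar>x 0\<bar> powr s) \<le> ennreal 8" .
    show "A_p 1 p (\<lambda>x. \<bar>x 0\<bar> powr (t - 1)) (\<lambda>x. \<bar>x 0\<bar> powr s) \<le> ennreal x"
      using A_p_power_dual_le[of t s p] t s p by simp
    have "ennreal (sqrt x / 9) \<le> ennreal (sqrt n / 3)" using sqrt by (rule ennreal_leI)
    also have "\<dots> \<le> S_norm 1 p (\<lambda>x. \<bar>x 0\<bar> powr (t - 1)) (\<lambda>x. \<bar>x 0\<bar> powr s)"
      using S_norm_power_dual_ge[OF t(1,2) nt _ s(1,3)] p by simp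
    finally show "ennreal (sqrt x / 9) \<le> S_norm 1 p (\<lambda>x. \<bar>x 0\<bar> powr (t - 1)) (\<lambda>x. \<bar>x 0\<bar> powr s)" .
  qed (rule lpi)+
qed

section \<open>Lower bounds for the growth functions\<close>

lemma growth_fun_ge_1: "growth_fun \<psi> \<Longrightarrow> 1 \<le> x \<Longrightarrow> 1 \<le> \<psi> x"
  by (auto simp: growth_fun_def)

lemma growth_fun_enn2real_le:
  assumes "growth_fun \<psi>" "1 \<le> a" "a \<le> ennreal x" "1 \<le> x"
  shows "\<psi> (enn2real a) \<le> \<psi> x"
proof -
  have "a < top" using le_less_trans[OF assms(3) ennreal_less_top] .
  hence "1 \<le> enn2real a" using enn2real_mono[OF assms(2)] by simp
  moreover have "enn2real a \<le> x" using enn2real_mono[OF assms(3)] assms(4) by simp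
  ultimately show ?thesis
    using assms(1,4) by (auto simp: growth_fun_def intro: mono_onD)
qed

lemma norm_bound_real:
  assumes "ennreal L \<le> S" "S \<le> C * epowr a r * ennreal Y"
    and "a \<le> ennreal K" "0 \<le> K" "0 \<le> r" "0 \<le> Y" "C < \<infinity>"
  shows "L \<le> enn2real C * K powr r * Y"
proof -
  have "ennreal L \<le> C * epowr a r * ennreal Y" using assms(1,2) by order
  also have "\<dots> \<le> C * epowr (ennreal K) r * ennreal Y"
    using assms by (intro mult_right_mono mult_left_mono epowr_mono) auto
  also have "\<dots> = ennreal (enn2real C * K powr r * Y)"
    using assms by (simp add: epowr_ennreal ennreal_mult)
  finally show ?thesis using assms by (subst (asm) ennreal_le_iff) auto
qed

text \<open>Since \<open>y \<ge> 1\<close>, \<open>B + y \<le> (B + 1) * y\<close>. Passing to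
  \<open>C + 1\<close> keeps the constant positive even for \<open>C = 0\<close>.\<close>

lemma absorb_bounded_summand:
  fixes B C K L y :: real
  assumes "L \<le> C * K * (B + y)" "0 \<le> B" "0 \<le> C" "0 < K" "1 \<le> y"
  shows "L / K \<le> (C + 1) * (B + 1) * y"
proof -
  have "L / K \<le> C * (B + y)" using assms by (simp add: field_simps)
  also have "\<dots> \<le> (C + 1) * ((B + 1) * y)"
    using assms mult_left_mono[of 1 y B] by (intro mult_mono) (auto simp: algebra_simps)
  finally show ?thesis by (simp add: mult.assoc)
qed

lemma psi_lower_bound:
  assumes p: "1 < p" and \<psi>: "growth_fun \<psi>" and "C < \<infinity>" "0 \<le> B"
    and bound: "\<And>w \<sigma>. is_weight 1 w \<Longrightarrow> is_weight 1 \<sigma> \<Longrightarrow> A_infty 1 \<sigma> < \<infinity> \<Longrightarrow>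
      1 \<le> A_infty 1 w \<Longrightarrow> A_infty 1 w \<le> ennreal (4 * 2 powr (p - 1)) \<Longrightarrow>
      S_norm 1 p w \<sigma> \<le> C * epowr (A_p 1 p w \<sigma>) (1 / p) * ennreal (B + \<psi> (enn2real (A_infty 1 \<sigma>)))"
  shows "\<exists>c>0. \<forall>x\<ge>1. x > 16 \<longrightarrow> \<psi> x \<ge> c * x powr (1 / p)"
proof -
  define D where "D = (enn2real C + 1) * (B + 1)"
  have D: "D > 0" unfolding D_def using \<open>0 \<le> B\<close> by (simp add: add_nonneg_pos)
  have "1 / (16 * D) * x powr (1 / p) \<le> \<psi> x" if x: "16 < x" for x
  proof -
    obtain w \<sigma> where w: "is_weight 1 w" "is_weight 1 \<sigma>"
      and \<sigma>: "1 \<le> A_infty 1 \<sigma>" "A_infty 1 \<sigma> \<le> ennreal x"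
      and wA: "1 \<le> A_infty 1 w" "A_infty 1 w \<le> ennreal (4 * 2 powr (p - 1))"
      and Ap: "A_p 1 p w \<sigma> \<le> ennreal (x powr (p - 1))" and S: "ennreal (x / 16) \<le> S_norm 1 p w \<sigma>"
      using ex_weights_large_sigma[OF p x] .
    have "\<psi> (enn2real (A_infty 1 \<sigma>)) \<le> \<psi> x"
      using growth_fun_enn2real_le[OF \<psi> \<sigma>] x by simp
    hence main: "S_norm 1 p w \<sigma> \<le> C * epowr (A_p 1 p w \<sigma>) (1 / p) * ennreal (B + \<psi> x)"
      using le_less_trans[OF \<sigma>(2) ennreal_less_top] wA
      by (intro order_trans[OF bound[OF w]] mult_left_mono ennreal_leI) auto
    have ge: "1 \<le> \<psi> x" using growth_fun_ge_1[OF \<psi>] x by simp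
    have "x / 16 \<le> enn2real C * (x powr (p - 1)) powr (1 / p) * (B + \<psi> x)"
      by (rule norm_bound_real[OF S main Ap]) (use p x ge \<open>C < \<infinity>\<close> \<open>0 \<le> B\<close> in auto)
    from absorb_bounded_summand[OF this]
    have "x / 16 / (x powr (p - 1)) powr (1 / p) \<le> D * \<psi> x"
      unfolding D_def
      using \<open>0 \<le> B\<close> ge x by simp
    moreover have "x / (x powr (p - 1)) powr (1 / p) = x powr (1 / p)"
    proof -
      have "x / (x powr (p - 1)) powr (1 / p) = x powr 1 / x powr ((p - 1) * (1 / p))"
        using x by (simp add: powr_powr)
      also have "\<dots> = x powr (1 - (p - 1) * (1 / p))" by (rule powr_diff[symmetric])
      also have "1 - (p - 1) * (1 / p) = 1 / p" using p by (simp add: field_simps)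
      finally show ?thesis .
    qed
    ultimately show ?thesis using D by (simp add: field_simps)
  qed
  thus ?thesis using D by (intro exI[of _ "1 / (16 * D)"]) auto
qed

text \<open>Here \<open>B\<close> is meant to bound \<open>\<psi>\<close> on \<open>[1,8]\<close>.
  The norm grows like \<open>sqrt x\<close> and the \<open>A_p\<close> factor is at most
  \<open>x powr (1 / p)\<close>, which yields the exponent.\<close>

lemma phi_lower_bound:
  assumes p: "2 < p" and \<phi>: "growth_fun \<phi>" and "C < \<infinity>" "0 \<le> B"
    and bound: "\<And>w \<sigma>. is_weight 1 w \<Longrightarrow> is_weight 1 \<sigma> \<Longrightarrow> A_infty 1 w < \<infinity> \<Longrightarrow>
      1 \<le> A_infty 1 \<sigma> \<Longrightarrow> A_infty 1 \<sigma> \<le> ennreal 8 \<Longrightarrow>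
      S_norm 1 p w \<sigma> \<le> C * epowr (A_p 1 p w \<sigma>) (1 / p) * ennreal (B + \<phi> (enn2real (A_infty 1 w)))"
  shows "\<exists>c>0. \<forall>x\<ge>1. x > 16 \<longrightarrow> \<phi> x \<ge> c * x powr (1 / 2 - 1 / p)"
proof -
  define D where "D = (enn2real C + 1) * (B + 1)"
  have D: "D > 0" unfolding D_def using \<open>0 \<le> B\<close> by (simp add: add_nonneg_pos)
  have "1 / (9 * D) * x powr (1 / 2 - 1 / p) \<le> \<phi> x" if x: "16 < x" for x
  proof -
    obtain w \<sigma> where w: "is_weight 1 w" "is_weight 1 \<sigma>"
      and wA: "1 \<le> A_infty 1 w" "A_infty 1 w \<le> ennreal x"
      and \<sigma>: "1 \<le> A_infty 1 \<sigma>" "A_infty 1 \<sigma> \<le> ennreal 8"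
      and Ap: "A_p 1 p w \<sigma> \<le> ennreal x" and S: "ennreal (sqrt x / 9) \<le> S_norm 1 p w \<sigma>"
      using ex_weights_large_w[OF p x] .
    have "\<phi> (enn2real (A_infty 1 w)) \<le> \<phi> x"
      using growth_fun_enn2real_le[OF \<phi> wA] x by simp
    hence main: "S_norm 1 p w \<sigma> \<le> C * epowr (A_p 1 p w \<sigma>) (1 / p) * ennreal (B + \<phi> x)"
      using le_less_trans[OF wA(2) ennreal_less_top] \<sigma>
      by (intro order_trans[OF bound[OF w]] mult_left_mono ennreal_leI) auto
    have ge: "1 \<le> \<phi> x" using growth_fun_ge_1[OF \<phi>] x by simp
    have "sqrt x / 9 \<le> enn2real C * x powr (1 / p) * (B + \<phi> x)"
      by (rule norm_bound_real[OF S main Ap]) (use p x ge \<open>C < \<infinity>\<close> \<open>0 \<le> B\<close> in auto)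
    from absorb_bounded_summand[OF this]
    have "sqrt x / 9 / x powr (1 / p) \<le> D * \<phi> x"
      unfolding D_def
      using \<open>0 \<le> B\<close> ge x by simp
    moreover have "sqrt x / x powr (1 / p) = x powr (1 / 2 - 1 / p)"
      using x by (simp add: powr_diff powr_half_sqrt)
    ultimately show ?thesis using D by (simp add: field_simps)
  qed
  thus ?thesis using D by (intro exI[of _ "1 / (9 * D)"]) auto
qed

theorem proposition1p3:
  shows
    "(\<exists>A>0. \<forall>(p::real) (\<psi>::real \<Rightarrow> real).
        1 < p \<and> p \<le> 2 \<and> growth_fun \<psi> \<and>
        (\<forall>d\<ge>1. \<exists>C::ennreal. C < \<infinity> \<and>
          (\<forall>w \<sigma>. is_weight d w \<and> is_weight d \<sigma> \<and> A_infty d \<sigma> < \<infinity> \<longrightarrow>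
            S_norm d p w \<sigma> \<le> C * epowr (A_p d p w \<sigma>) (1/p) * ennreal (\<psi> (enn2real (A_infty d \<sigma>)))))
        \<longrightarrow> (\<exists>c>0. \<forall>x\<ge>1. x > A \<longrightarrow> \<psi> x \<ge> c * x powr (1/p)))
     \<and>
     (\<exists>A>0. \<exists>B>0. \<forall>(p::real) (\<phi>::real \<Rightarrow> real) (\<psi>::real \<Rightarrow> real).
        2 < p \<and> growth_fun \<phi> \<and> growth_fun \<psi> \<and>
        (\<forall>d\<ge>1. \<exists>C::ennreal. C < \<infinity> \<and>
          (\<forall>w \<sigma>. is_weight d w \<and> is_weight d \<sigma> \<and> A_infty d \<sigma> < \<infinity> \<and> A_infty d w < \<infinity> \<longrightarrow>
            S_norm d p w \<sigma> \<le> C * epowr (A_p d p w \<sigma>) (1/p) *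
              ennreal (\<phi> (enn2real (A_infty d w)) + \<psi> (enn2real (A_infty d \<sigma>)))))
        \<longrightarrow> (\<exists>c>0. \<forall>x\<ge>1. x > A \<longrightarrow> \<psi> x \<ge> c * x powr (1/p)) \<and>
            (\<exists>c>0. \<forall>x\<ge>1. x > B \<longrightarrow> \<phi> x \<ge> c * x powr (1/2 - 1/p)))"
proof (rule conjI)
  show "\<exists>A>0. \<forall>(p::real) (\<psi>::real \<Rightarrow> real).
        1 < p \<and> p \<le> 2 \<and> growth_fun \<psi> \<and>
        (\<forall>d\<ge>1. \<exists>C::ennreal. C < \<infinity> \<and>
          (\<forall>w \<sigma>. is_weight d w \<and> is_weight d \<sigma> \<and> A_infty d \<sigma> < \<infinity> \<longrightarrow>
            S_norm d p w \<sigma> \<le> C * epowr (A_p d p w \<sigma>) (1/p) * ennreal (\<psi> (enn2real (A_infty d \<sigma>)))))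
        \<longrightarrow> (\<exists>c>0. \<forall>x\<ge>1. x > A \<longrightarrow> \<psi> x \<ge> c * x powr (1/p))"
  proof (rule exI[of _ "16"], intro conjI allI impI, simp, elim conjE)
    fix p \<psi> assume p: "1 < p" and \<psi>: "growth_fun \<psi>" and
      "\<forall>d\<ge>1. \<exists>C::ennreal. C < \<infinity> \<and>
          (\<forall>w \<sigma>. is_weight d w \<and> is_weight d \<sigma> \<and> A_infty d \<sigma> < \<infinity> \<longrightarrow>
            S_norm d p w \<sigma> \<le> C * epowr (A_p d p w \<sigma>) (1/p) * ennreal (\<psi> (enn2real (A_infty d \<sigma>))))"
    then obtain C where C: "C < \<infinity>" and bound: "\<And>w \<sigma>. is_weight 1 w \<Longrightarrow> is_weight 1 \<sigma> \<Longrightarrow> A_infty 1 \<sigma> < \<infinity> \<Longrightarrow>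
        S_norm 1 p w \<sigma> \<le> C * epowr (A_p 1 p w \<sigma>) (1/p) * ennreal (\<psi> (enn2real (A_infty 1 \<sigma>)))"
      by (metis order_refl)
    show "\<exists>c>0. \<forall>x\<ge>1. x > 16 \<longrightarrow> \<psi> x \<ge> c * x powr (1/p)"
      by (rule psi_lower_bound[OF p \<psi> C, of 0]) (use bound in auto)
  qed
  show "\<exists>A>0. \<exists>B>0. \<forall>(p::real) (\<phi>::real \<Rightarrow> real) (\<psi>::real \<Rightarrow> real).
        2 < p \<and> growth_fun \<phi> \<and> growth_fun \<psi> \<and>
        (\<forall>d\<ge>1. \<exists>C::ennreal. C < \<infinity> \<and>
          (\<forall>w \<sigma>. is_weight d w \<and> is_weight d \<sigma> \<and> A_infty d \<sigma> < \<infinity> \<and> A_infty d w < \<infinity> \<longrightarrow>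
            S_norm d p w \<sigma> \<le> C * epowr (A_p d p w \<sigma>) (1/p) *
              ennreal (\<phi> (enn2real (A_infty d w)) + \<psi> (enn2real (A_infty d \<sigma>)))))
        \<longrightarrow> (\<exists>c>0. \<forall>x\<ge>1. x > A \<longrightarrow> \<psi> x \<ge> c * x powr (1/p)) \<and>
            (\<exists>c>0. \<forall>x\<ge>1. x > B \<longrightarrow> \<phi> x \<ge> c * x powr (1/2 - 1/p))"
  proof (rule exI[of _ "16"], rule conjI, simp, rule exI[of _ "16"], rule conjI, simp, intro allI impI, elim conjE)
    fix p \<phi> \<psi> assume p: "2 < p" and \<phi>: "growth_fun \<phi>" and \<psi>: "growth_fun \<psi>" and
      "\<forall>d\<ge>1. \<exists>C::ennreal. C < \<infinity> \<and>
          (\<forall>w \<sigma>. is_weight d w \<and> is_weight d \<sigma> \<and> A_infty d \<sigma> < \<infinity> \<and> A_infty d w < \<infinity> \<longrightarrow>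
            S_norm d p w \<sigma> \<le> C * epowr (A_p d p w \<sigma>) (1/p) *
              ennreal (\<phi> (enn2real (A_infty d w)) + \<psi> (enn2real (A_infty d \<sigma>))))"
    then obtain C where C: "C < \<infinity>" and bound: "\<And>w \<sigma>. is_weight 1 w \<Longrightarrow> is_weight 1 \<sigma> \<Longrightarrow>
        A_infty 1 \<sigma> < \<infinity> \<Longrightarrow> A_infty 1 w < \<infinity> \<Longrightarrow>
        S_norm 1 p w \<sigma> \<le> C * epowr (A_p 1 p w \<sigma>) (1/p) *
          ennreal (\<phi> (enn2real (A_infty 1 w)) + \<psi> (enn2real (A_infty 1 \<sigma>)))"
      by (metis order_refl)
    have K: "1 \<le> 4 * 2 powr (p - 1)" using p ge_one_powr_ge_zero[of 2 "p - 1"] by linarith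
    show "(\<exists>c>0. \<forall>x\<ge>1. x > 16 \<longrightarrow> \<psi> x \<ge> c * x powr (1/p)) \<and>
        (\<exists>c>0. \<forall>x\<ge>1. x > 16 \<longrightarrow> \<phi> x \<ge> c * x powr (1/2 - 1/p))"
    proof
      show "\<exists>c>0. \<forall>x\<ge>1. x > 16 \<longrightarrow> \<psi> x \<ge> c * x powr (1/p)"
      proof (rule psi_lower_bound[OF _ \<psi> C])
        \<comment> \<open>The summand \<open>B\<close> is this value: by monotonicity it bounds
          \<open>\<phi>\<close> at the \<open>A_infty\<close> constant of every \<open>w\<close>
          considered.\<close>
        show "0 \<le> \<phi> (4 * 2 powr (p - 1))" using growth_fun_ge_1[OF \<phi> K] by simp
        fix w \<sigma> assume *: "is_weight 1 w" "is_weight 1 \<sigma>" "A_infty 1 \<sigma> < \<infinity>"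
          "1 \<le> A_infty 1 w" "A_infty 1 w \<le> ennreal (4 * 2 powr (p - 1))"
        have "A_infty 1 w < \<infinity>" using le_less_trans[OF *(5) ennreal_less_top] by simp
        from bound[OF *(1-3) this] growth_fun_enn2real_le[OF \<phi> *(4,5) K]
        show "S_norm 1 p w \<sigma> \<le> C * epowr (A_p 1 p w \<sigma>) (1/p) *
            ennreal (\<phi> (4 * 2 powr (p - 1)) + \<psi> (enn2real (A_infty 1 \<sigma>)))"
          by (elim order_trans) (intro mult_left_mono ennreal_leI, auto)
      qed (use p in simp)
      show "\<exists>c>0. \<forall>x\<ge>1. x > 16 \<longrightarrow> \<phi> x \<ge> c * x powr (1/2 - 1/p)"
      proof (rule phi_lower_bound[OF p \<phi> C])
        show "0 \<le> \<psi> 8" using growth_fun_ge_1[OF \<psi>, of 8] by simp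
        fix w \<sigma> assume *: "is_weight 1 w" "is_weight 1 \<sigma>" "A_infty 1 w < \<infinity>"
          "1 \<le> A_infty 1 \<sigma>" "A_infty 1 \<sigma> \<le> ennreal 8"
        have "A_infty 1 \<sigma> < \<infinity>" using le_less_trans[OF *(5) ennreal_less_top] by simp
        from bound[OF *(1,2) this *(3)] growth_fun_enn2real_le[OF \<psi> *(4,5)]
        show "S_norm 1 p w \<sigma> \<le> C * epowr (A_p 1 p w \<sigma>) (1/p) *
            ennreal (\<psi> 8 + \<phi> (enn2real (A_infty 1 w)))"
          by (elim order_trans) (intro mult_left_mono ennreal_leI, auto)
      qed
    qed
  qed
qed

end
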